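(* Let $0<q<p<1$. Then none of the spaces $$\ell_p\oplus\ell_q,\quad \ell_p(\ell_q),\quad \ell_q(\ell_p),\quad \Big(\bigoplus_{n=1}^\infty\ell_q^n\Big)_{\ell_p},\quad \Big(\bigoplus_{n=1}^\infty\ell_p^n\Big)_{\ell_q}$$ has an almost greedy basis.
   Context: For $0<r,s<\infty$, $\ell_r(\ell_s)$ is the space of sequences $(f_k)_{k=1}^\infty$ in $\ell_s$ with $(\sum_k\|f_k\|_{\ell_s}^r)^{1/r}<\infty$, and $(\bigoplus_{n}\ell_s^n)_{\ell_r}$ is the space of sequences $(f_n)_{n=1}^\infty$ with $f_n\in\ell_s^n$ and $(\sum_n\|f_n\|_{\ell_s^n}^r)^{1/r}<\infty$. A basis of a quasi-Banach space $\mathbb{X}$ over $\mathbb{R}$ or $\mathbb{C}$ is a norm-bounded countable family $\mathcal{X}=(\boldsymbol x_n)_{n\in\mathcal{N}}$ whose closed linear span is $\mathbb{X}$ and for which there is a norm-bounded family $(\boldsymbol x_n^* )_{n\in\mathcal{N}}$ in $\mathbb{X}^*$ with $\boldsymbol x_n^*(\boldsymbol x_k)=\delta_{n,k}$. Identify $\mathcal{N}$ with $\mathbb{N}$ via a fixed enumeration. For $f\in\mathbb{X}$ and $m\in\mathbb{N}$, $A_m(f)$ is the unique set of cardinality $m$ such that whenever $i\in A_m(f)$ and $j\notin A_m(f)$, either $|\boldsymbol x_i^*(f)|>|\boldsymbol x_j^*(f)|$, or $|\boldsymbol x_i^*(f)|=|\boldsymbol x_j^*(f)|$ and $i<j$;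 $\mathcal{G}_m(f)=\sum_{n\in A_m(f)}\boldsymbol x_n^*(f)\boldsymbol x_n$. A basis is almost greedy if there is $C$ with $\|f-\mathcal{G}_m(f)\|\le C\inf\{\|f-\sum_{n\in A}\boldsymbol x_n^*(f)\boldsymbol x_n\|:|A|\le m\}$ for all $f,m$; equivalently (known) it is quasi-greedy (i.e. $\sup_m\|\mathcal{G}_m(f)\|\le C\|f\|$ for some $C$ and all $f$) and democratic (i.e. there is $D$ with $\|\sum_{n\in A}\boldsymbol x_n\|\le D\|\sum_{n\in B}\boldsymbol x_n\|$ for all finite $A,B$ with $|A|\le|B|$). *)

theory Defs
  imports
    "HOL-Analysis.Analysis"
    "HOL-Library.Function_Algebras"
begin

text \<open>
  A quasi-normed space over \<open>'k\<close> is given by a carrier, a scalar multiplication and a quasi-norm on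
  an ambient additive group \<open>'v\<close>; vector addition is that of \<open>'v\<close>. The class
  \<^class>\<open>real_normed_vector\<close> cannot be used, as the quasi-norm of \<open>\<ell>\<^sub>p\<close> is not subadditive for
  \<open>p < 1\<close>.
\<close>

record ('k, 'v) qspace =
  carrier :: "'v set"
  smult :: "'k \<Rightarrow> 'v \<Rightarrow> 'v"
  qnorm :: "'v \<Rightarrow> real"


subsection \<open>The spaces\<close>

definition scalars :: "('k::real_normed_field, 'k) qspace" where
  "scalars = \<lparr>carrier = UNIV, smult = (*), qnorm = norm\<rparr>"

text \<open>The space of sequences \<open>f\<close> with \<open>f n \<in> X n\<close> and \<open>(\<Sum>n. \<parallel>f n\<parallel>\<^sup>r)\<^sup>1\<^sup>/\<^sup>r < \<infinity>\<close>.\<close>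

definition lsum :: "real \<Rightarrow> (nat \<Rightarrow> ('k, 'v) qspace) \<Rightarrow> ('k, nat \<Rightarrow> 'v) qspace" where
  "lsum r X =
    \<lparr>carrier = {f. (\<forall>n. f n \<in> carrier (X n)) \<and> summable (\<lambda>n. qnorm (X n) (f n) powr r)},
     smult = (\<lambda>c f n. smult (X n) c (f n)),
     qnorm = (\<lambda>f. (\<Sum>n. qnorm (X n) (f n) powr r) powr (1 / r))\<rparr>"

definition lp :: "'k itself \<Rightarrow> real \<Rightarrow> ('k::real_normed_field, nat \<Rightarrow> 'k) qspace" where
  "lp K r = lsum r (\<lambda>_. scalars)"

text \<open>\<open>\<ell>\<^sub>r\<^sup>n\<close>: its vectors \<open>(f 0, \<dots>, f (n - 1))\<close> are extended by \<open>0\<close> to sequences.\<close>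

definition lp_fin ::
    "'k itself \<Rightarrow> real \<Rightarrow> nat \<Rightarrow> ('k::real_normed_field, nat \<Rightarrow> 'k) qspace" where
  "lp_fin K r n =
    \<lparr>carrier = {f. \<forall>i\<ge>n. f i = 0},
     smult = (\<lambda>c f i. c * f i),
     qnorm = (\<lambda>f. (\<Sum>i<n. norm (f i) powr r) powr (1 / r))\<rparr>"

text \<open>The maximum is one of the usual equivalent quasi-norms on a direct sum of two spaces; passing
  to an equivalent quasi-norm does not affect which bases are almost greedy.\<close>

definition dsum :: "('k, 'v) qspace \<Rightarrow> ('k, 'w) qspace \<Rightarrow> ('k, 'v \<times> 'w) qspace"  (infixr \<open>\<oplus>\<close> 65) where
  "X \<oplus> Y =
    \<lparr>carrier = carrier X \<times> carrier Y,
     smult = (\<lambda>c (f, g). (smult X c f, smult Y c g)),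
     qnorm = (\<lambda>(f, g). max (qnorm X f) (qnorm Y g))\<rparr>"


subsection \<open>Bases\<close>

definition linear_functional ::
    "('k::real_normed_field, 'v::ab_group_add) qspace \<Rightarrow> ('v \<Rightarrow> 'k) \<Rightarrow> bool" where
  "linear_functional X \<phi> \<longleftrightarrow>
    (\<forall>f\<in>carrier X. \<forall>g\<in>carrier X. \<phi> (f + g) = \<phi> f + \<phi> g) \<and>
    (\<forall>c. \<forall>f\<in>carrier X. \<phi> (smult X c f) = c * \<phi> f)"

text \<open>The third conjunct says that the closed linear span of the family is the whole space. The
  fifth one says that the functionals lie in the dual space and that their norms are bounded.\<close>

definition basis_with_dual ::
    "('k::real_normed_field, 'v::ab_group_add) qspace \<Rightarrow> (nat \<Rightarrow> 'v) \<Rightarrow> (nat \<Rightarrow> 'v \<Rightarrow> 'k) \<Rightarrow> bool" where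
  "basis_with_dual X x x' \<longleftrightarrow>
    (\<forall>n. x n \<in> carrier X) \<and>
    (\<exists>C. \<forall>n. qnorm X (x n) \<le> C) \<and>
    (\<forall>f\<in>carrier X. \<forall>e>0. \<exists>g\<in>module.span (smult X) (range x). qnorm X (f - g) < e) \<and>
    (\<forall>n. linear_functional X (x' n)) \<and>
    (\<exists>C. \<forall>n. \<forall>f\<in>carrier X. norm (x' n f) \<le> C * qnorm X f) \<and>
    (\<forall>n k. x' n (x k) = (if n = k then 1 else 0))"

definition coord_proj ::
    "('k, 'v::ab_group_add) qspace \<Rightarrow> (nat \<Rightarrow> 'v) \<Rightarrow> (nat \<Rightarrow> 'v \<Rightarrow> 'k) \<Rightarrow> nat set \<Rightarrow> 'v \<Rightarrow> 'v" where
  "coord_proj X x x' A f = (\<Sum>n\<in>A. smult X (x' n f) (x n))"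

definition greedy_set :: "(nat \<Rightarrow> 'v \<Rightarrow> 'k::real_normed_field) \<Rightarrow> nat \<Rightarrow> 'v \<Rightarrow> nat set" where
  "greedy_set x' m f =
    (THE A. finite A \<and> card A = m \<and>
      (\<forall>i\<in>A. \<forall>j. j \<notin> A \<longrightarrow>
        norm (x' i f) > norm (x' j f) \<or> (norm (x' i f) = norm (x' j f) \<and> i < j)))"

definition greedy_approx ::
    "('k::real_normed_field, 'v::ab_group_add) qspace \<Rightarrow> (nat \<Rightarrow> 'v) \<Rightarrow> (nat \<Rightarrow> 'v \<Rightarrow> 'k) \<Rightarrow>
      nat \<Rightarrow> 'v \<Rightarrow> 'v" where
  "greedy_approx X x x' m f = coord_proj X x x' (greedy_set x' m f) f"

text \<open>The functionals of a basis are determined on the carrier by biorthogonality and density of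
  the span, so it does not matter that they are quantified existentially.\<close>

definition almost_greedy_basis ::
    "('k::real_normed_field, 'v::ab_group_add) qspace \<Rightarrow> (nat \<Rightarrow> 'v) \<Rightarrow> bool" where
  "almost_greedy_basis X x \<longleftrightarrow>
    (\<exists>x'. basis_with_dual X x x' \<and>
      (\<exists>C. \<forall>f\<in>carrier X. \<forall>m.
        qnorm X (f - greedy_approx X x x' m f) \<le>
          C * (INF A\<in>{A. finite A \<and> card A \<le> m}. qnorm X (f - coord_proj X x x' A f))))"

definition has_almost_greedy_basis ::
    "('k::real_normed_field, 'v::ab_group_add) qspace \<Rightarrow> bool" where
  "has_almost_greedy_basis X \<longleftrightarrow> (\<exists>x. almost_greedy_basis X x)"

end

theory Submission
  imports Defs
begin

text \<open>
  Each space contains unit vectors \<open>e\<^sub>i\<close> with coordinate functionals \<open>c\<^sub>i\<close>, and \<open>\<Sum>\<^sub>i |c\<^sub>i f|\<^sup>p\<close> is at most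
  a constant times \<open>\<parallel>f\<parallel>\<^sup>p\<close>. Let \<open>x\<close> be an almost greedy basis with functionals \<open>x'\<close>. It is democratic in
  the strong sense that \<open>t \<parallel>\<Sum>\<^sub>n\<^sub>\<in>\<^sub>B v\<^sub>n x\<^sub>n\<parallel> \<le> C \<parallel>f\<parallel>\<close> whenever \<open>|v\<^sub>n| \<le> 1\<close> and \<open>f\<close> has at least \<open>|B|\<close>
  coefficients of modulus at least \<open>t\<close>.

  As \<open>p < 1\<close>, a sum \<open>\<Sum>\<^sub>i a\<^sub>i b\<^sub>i\<close> of size \<open>1\<close> with bounded \<open>b\<close> and \<open>a\<close> bounded in (weak) \<open>\<ell>\<^sub>p\<close> has a term
  with both factors large. Expanding \<open>x'\<^sub>n x\<^sub>n = 1\<close> in the unit vectors, every \<open>n\<close> has an \<open>i\<close> for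
  which \<open>c\<^sub>i x\<^sub>n\<close> and \<open>x'\<^sub>n e\<^sub>i\<close> are large. Hence the coefficients of \<open>f\<close> are bounded by \<open>\<parallel>f\<parallel>\<close> in weak
  \<open>\<ell>\<^sub>p\<close>, so that expanding \<open>c\<^sub>i e\<^sub>i = 1\<close> in the basis conversely gives every \<open>i\<close> such an \<open>n = \<nu> i\<close>, with
  fibres of \<open>\<nu>\<close> of bounded size.

  Averaging over subsets, suitable subsums of \<open>m\<close> unit vectors spanning \<open>\<ell>\<^sub>p\<^sup>m\<close> have about \<open>m\<close> large
  coefficients and norm at most \<open>m\<^sup>1\<^sup>/\<^sup>p\<close>, while suitable sums of at most \<open>m\<close> basis vectors have about
  \<open>m\<close> large coordinates in a copy of \<open>\<ell>\<^sub>q\<^sup>m\<close>, hence norm at least of order \<open>m\<^sup>1\<^sup>/\<^sup>q\<close>. This contradicts the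
  strong democracy for large \<open>m\<close>.
\<close>

subsection \<open>Combinatorial and summation lemmas\<close>

text \<open>For fixed \<open>j\<close> pick \<open>n\<close> in \<open>A\<close> with
  \<open>a n j\<close> large. Toggling the membership of \<open>n\<close> in \<open>S\<close>
  changes the \<open>j\<close>-th sum by \<open>a n j\<close>, so one of the two sums has norm at
  least \<open>d / 2\<close>. Hence at least half of all subsets are good for \<open>j\<close>, and
  averaging over the subsets gives one that is good for at least half of \<open>J\<close>. This does
  the work of random signs.\<close>

lemma exists_subset_half_large:
  fixes a :: "'a \<Rightarrow> 'b \<Rightarrow> 'k::real_normed_vector"
  assumes A: "finite A" and J: "finite J"
    and large: "\<And>j. j \<in> J \<Longrightarrow> \<exists>n\<in>A. d \<le> norm (a n j)"
  shows "\<exists>S\<subseteq>A. card J \<le> 2 * card {j\<in>J. d / 2 \<le> norm (\<Sum>n\<in>S. a n j)}"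
proof -
  define good where "good S j \<longleftrightarrow> d / 2 \<le> norm (\<Sum>n\<in>S. a n j)" for S j
  have half: "card (Pow A) \<le> 2 * card {S\<in>Pow A. good S j}" if "j \<in> J" for j
  proof -
    obtain n where n: "n \<in> A" "d \<le> norm (a n j)"
      using large[OF \<open>j \<in> J\<close>] by blast
    define flip where "flip S = (if n \<in> S then S - {n} else insert n S)" for S
    have flip_good: "good (flip S) j" if S: "S \<subseteq> A" "\<not> good S j" for S
    proof -
      have fin: "finite S"
        using S A finite_subset by blast
      have "norm ((\<Sum>m\<in>flip S. a m j) - (\<Sum>m\<in>S. a m j)) = norm (a n j)"
        using fin by (simp add: flip_def sum.remove[where x = n])
      then show ?thesis
        using S(2) n(2) norm_triangle_ineq4[of "\<Sum>m\<in>flip S. a m j" "\<Sum>m\<in>S. a m j"]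
        unfolding good_def by linarith
    qed
    have flip_subset: "flip S \<subseteq> A" if "S \<subseteq> A" for S
      using that n(1) by (auto simp: flip_def)
    \<comment> \<open>\<open>flip\<close> is an involution that maps bad subsets to good ones, so
      the bad ones are not more numerous.\<close>
    have "card {S\<in>Pow A. \<not> good S j} \<le> card {S\<in>Pow A. good S j}"
    proof (rule card_inj_on_le)
      show "inj_on flip {S\<in>Pow A. \<not> good S j}"
        by (rule inj_on_inverseI[where g = flip]) (auto simp: flip_def)
      show "flip ` {S\<in>Pow A. \<not> good S j} \<subseteq> {S\<in>Pow A. good S j}"
        using flip_good flip_subset by blast
      show "finite {S\<in>Pow A. good S j}"
        using A by simp
    qed
    moreover have "card (Pow A) = card {S\<in>Pow A. good S j} + card {S\<in>Pow A. \<not> good S j}"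
      using A by (subst card_Un_disjoint[symmetric]) (auto intro: arg_cong[where f = card])
    ultimately show ?thesis
      by simp
  qed
  have "\<exists>S\<in>Pow A. card J \<le> 2 * card {j\<in>J. good S j}"
  proof (rule ccontr)
    assume "\<not> ?thesis"
    then have "2 * card {j\<in>J. good S j} < card J" if "S \<in> Pow A" for S
      using that by (meson not_le)
    then have "(\<Sum>S\<in>Pow A. 2 * card {j\<in>J. good S j}) < (\<Sum>S\<in>Pow A. card J)"
      using A by (intro sum_strict_mono) auto
    also have "\<dots> = (\<Sum>j\<in>J. card (Pow A))"
      by simp
    also have "\<dots> \<le> (\<Sum>j\<in>J. 2 * card {S\<in>Pow A. good S j})"
      using half by (rule sum_mono)
    \<comment> \<open>Double counting of the pairs \<open>S\<close>, \<open>j\<close> with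
      \<open>good S j\<close>.\<close>
    also have "\<dots> = (\<Sum>S\<in>Pow A. 2 * card {j\<in>J. good S j})"
    proof -
      have "(\<Sum>j\<in>J. card {S\<in>Pow A. good S j}) = (\<Sum>S\<in>Pow A. card {j\<in>J. good S j})"
        using A J sum_multicount_gen[of J "Pow A" "\<lambda>j S. good S j" "\<lambda>S. card {j\<in>J. good S j}"]
        by simp
      then show ?thesis
        by (simp only: sum_distrib_left[symmetric])
    qed
    finally show False
      by simp
  qed
  then show ?thesis
    by (auto simp: good_def)
qed

text \<open>Dyadic layers: with \<open>m\<close> the largest term, the terms between
  \<open>m / 2\<close> and \<open>m\<close> add up to at most
  \<open>2 powr p * M * m powr (1 - p)\<close> by the weak-type bound, and the remaining terms are
  below \<open>m / 2\<close>. As \<open>p < 1\<close>, the layer bounds form a geometric series of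
  ratio \<open>2 powr (p - 1)\<close>. The positive power of \<open>d\<close> makes small terms
  negligible.\<close>

lemma sum_le_of_weak_type:
  fixes a :: "'a \<Rightarrow> real"
  assumes p: "0 < p" "p < 1" and "finite S"
    and weak: "\<And>t. 0 < t \<Longrightarrow> t powr p * card {n\<in>S. t \<le> a n} \<le> M"
    and "\<And>n. n \<in> S \<Longrightarrow> 0 \<le> a n \<and> a n \<le> d"
  shows "(\<Sum>n\<in>S. a n) \<le> 2 powr p * M / (1 - 2 powr (p - 1)) * d powr (1 - p)"
  using \<open>finite S\<close> weak assms(5)
proof (induction "card S" arbitrary: S d rule: less_induct)
  case less
  define Q where "Q = 2 powr p * M / (1 - 2 powr (p - 1))"
  have M: "0 \<le> M"
    using order_trans[OF _ less.prems(2)[of 1]] by simp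
  have "2 powr (p - 1) < (1::real)"
    using p powr_less_cancel_iff[of 2 "p - 1" 0] by simp
  then have Q: "0 \<le> Q" and "Q * (1 - 2 powr (p - 1)) = 2 powr p * M"
    using M by (auto simp: Q_def)
  \<comment> \<open>\<open>Q\<close> is the fixed point for which the bound for the top layer plus
    the inductive bound for the rest reproduces the claim.\<close>
  then have Q_eq: "2 powr p * M + Q * 2 powr (p - 1) = Q"
    by (simp add: right_diff_distrib)
  show ?case
  proof (cases "\<forall>n\<in>S. a n = 0")
    case True
    then show ?thesis
      using mult_nonneg_nonneg[OF Q, of "d powr (1 - p)"] by (simp add: Q_def)
  next
    case False
    define m where "m = Max (a ` S)"
    have ne: "S \<noteq> {}"
      using False by auto
    have m_in: "m \<in> a ` S"
      unfolding m_def using less.prems(1) ne by (intro Max_in) auto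
    have le_m: "a n \<le> m" if "n \<in> S" for n
      unfolding m_def using less.prems(1) that by simp
    have m: "0 < m" "m \<le> d"
      using False le_m less.prems(3) m_in by (force simp: order_less_le)+
    define B where "B = {n\<in>S. m / 2 \<le> a n}"
    have B: "B \<subseteq> S" "B \<noteq> {}"
      using m_in m by (auto simp: B_def)
    \<comment> \<open>The maximum lies in \<open>B\<close>, so the rest is a smaller set, and the
      induction hypothesis applies to it with \<open>m / 2\<close> in place of
      \<open>d\<close>.\<close>
    have "card (S - B) < card S"
      using B less.prems(1) by (intro psubset_card_mono) auto
    then have rest: "(\<Sum>n\<in>S - B. a n) \<le> Q * (m / 2) powr (1 - p)"
      unfolding Q_def
    proof (rule less.hyps)
      show "finite (S - B)"
        using less.prems(1) by simp
      show "t powr p * card {n \<in> S - B. t \<le> a n} \<le> M" if "0 < t" for t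
      proof -
        have "card {n \<in> S - B. t \<le> a n} \<le> card {n \<in> S. t \<le> a n}"
          using less.prems(1) by (intro card_mono) auto
        then have "t powr p * card {n \<in> S - B. t \<le> a n} \<le> t powr p * card {n \<in> S. t \<le> a n}"
          by (intro mult_left_mono) auto
        then show ?thesis
          using less.prems(2)[OF that] by linarith
      qed
      show "0 \<le> a n \<and> a n \<le> m / 2" if "n \<in> S - B" for n
        using that less.prems(3)[of n] by (auto simp: B_def)
    qed
    have "(\<Sum>n\<in>B. a n) \<le> card B * m"
      using le_m B by (intro sum_bounded_above) auto
    also have "\<dots> = 2 powr p * m powr (1 - p) * ((m / 2) powr p * card B)"
      using m by (simp add: powr_divide powr_diff)
    also have "\<dots> \<le> 2 powr p * m powr (1 - p) * M"
      using less.prems(2)[of "m / 2"] m by (intro mult_left_mono) (auto simp: B_def)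
    finally have "(\<Sum>n\<in>S. a n) \<le> 2 powr p * m powr (1 - p) * M + Q * (m / 2) powr (1 - p)"
      using rest sum.subset_diff[OF B(1) less.prems(1), of a] by linarith
    also have "(m / 2) powr (1 - p) = 2 powr (p - 1) * m powr (1 - p)"
      using m by (simp add: powr_divide powr_diff field_simps)
    also have "2 powr p * m powr (1 - p) * M + Q * (2 powr (p - 1) * m powr (1 - p)) =
        (2 powr p * M + Q * 2 powr (p - 1)) * m powr (1 - p)"
      by (simp add: algebra_simps)
    also have "\<dots> \<le> Q * d powr (1 - p)"
      unfolding Q_eq using m p Q by (intro mult_left_mono powr_mono2) auto
    finally show ?thesis
      unfolding Q_def .
  qed
qed

text \<open>If no term has both factors at least \<open>d\<close>, the terms with
  \<open>a n < d\<close> sum to at most \<open>U * (Q * d powr (1 - p))\<close>, and the others,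
  where \<open>b n < d\<close>, to at most \<open>d * (Q * U powr (1 - p))\<close>. Both bounds tend
  to \<open>0\<close> with \<open>d\<close>, so a small \<open>d\<close>, depending only on
  \<open>p\<close>, \<open>M\<close> and \<open>U\<close>, contradicts the lower bound
  \<open>1 / 2\<close>.\<close>

lemma exists_jointly_large:
  fixes M U p :: real
  assumes p: "0 < p" "p < 1"
  obtains d where "0 < d" and "\<And>(S :: 'a set) a b. finite S \<Longrightarrow>
    (\<And>n. n \<in> S \<Longrightarrow> 0 \<le> a n \<and> a n \<le> U \<and> 0 \<le> b n \<and> b n \<le> U) \<Longrightarrow>
    (\<And>t. 0 < t \<Longrightarrow> t powr p * card {n\<in>S. t \<le> a n} \<le> M) \<Longrightarrow>
    1 / 2 \<le> (\<Sum>n\<in>S. a n * b n) \<Longrightarrow> \<exists>n\<in>S. d \<le> a n \<and> d \<le> b n"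
proof -
  define Q where "Q = 2 powr p * M / (1 - 2 powr (p - 1))"
  have "((\<lambda>d. d * (Q * U powr (1 - p)) + U * (Q * d powr (1 - p))) \<longlongrightarrow>
      0 * (Q * U powr (1 - p)) + U * (Q * 0 powr (1 - p))) (at_right 0)"
    using p by (intro tendsto_intros tendsto_powr')
      (auto intro: eventually_mono[OF eventually_at_right_less])
  then have "\<forall>\<^sub>F d in at_right 0. d * (Q * U powr (1 - p)) + U * (Q * d powr (1 - p)) < 1 / 2"
    by (rule order_tendstoD) simp
  then have "\<forall>\<^sub>F d in at_right 0. 0 < d \<and> d * (Q * U powr (1 - p)) + U * (Q * d powr (1 - p)) < 1 / 2"
    by (intro eventually_conj eventually_at_right_less)
  then obtain d where d: "0 < d" "d * (Q * U powr (1 - p)) + U * (Q * d powr (1 - p)) < 1 / 2"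
    using eventually_happens trivial_limit_at_right_real by blast
  show thesis
  proof (rule that[OF d(1)])
    fix S :: "'a set" and a b :: "'a \<Rightarrow> real"
    assume fin: "finite S" and bd: "\<And>n. n \<in> S \<Longrightarrow> 0 \<le> a n \<and> a n \<le> U \<and> 0 \<le> b n \<and> b n \<le> U"
      and weak: "\<And>t. 0 < t \<Longrightarrow> t powr p * card {n\<in>S. t \<le> a n} \<le> M"
      and big: "1 / 2 \<le> (\<Sum>n\<in>S. a n * b n)"
    have sub: "t powr p * card {n\<in>T. t \<le> a n} \<le> M" if "T \<subseteq> S" "0 < t" for T t
    proof -
      have "card {n \<in> T. t \<le> a n} \<le> card {n \<in> S. t \<le> a n}"
        using fin that by (intro card_mono) auto
      then have "t powr p * card {n \<in> T. t \<le> a n} \<le> t powr p * card {n \<in> S. t \<le> a n}"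
        by (intro mult_left_mono) auto
      then show ?thesis
        using weak[OF \<open>0 < t\<close>] by linarith
    qed
    show "\<exists>n\<in>S. d \<le> a n \<and> d \<le> b n"
    proof (rule ccontr)
      assume none: "\<not> ?thesis"
      define T where "T = {n\<in>S. a n < d}"
      have T: "T \<subseteq> S" "finite T"
        using fin by (auto simp: T_def)
      have "S \<noteq> {}"
        using big by auto
      then have U: "0 \<le> U"
        using bd by force
      have "(\<Sum>n\<in>T. a n * b n) \<le> (\<Sum>n\<in>T. U * a n)"
        using bd T by (intro sum_mono) (subst mult.commute, auto intro!: mult_right_mono)
      also have "\<dots> = U * (\<Sum>n\<in>T. a n)"
        by (simp add: sum_distrib_left)
      also have "\<dots> \<le> U * (Q * d powr (1 - p))"
        unfolding Q_def using U bd T(2) sub[OF T(1)] by (intro mult_left_mono sum_le_of_weak_type p) (auto simp: T_def)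
      finally have 1: "(\<Sum>n\<in>T. a n * b n) \<le> U * (Q * d powr (1 - p))" .
      have "(\<Sum>n\<in>S - T. a n * b n) \<le> (\<Sum>n\<in>S - T. d * a n)"
        using bd none by (intro sum_mono) (subst mult.commute, auto intro!: mult_right_mono simp: T_def)
      also have "\<dots> = d * (\<Sum>n\<in>S - T. a n)"
        by (simp add: sum_distrib_left)
      also have "\<dots> \<le> d * (Q * U powr (1 - p))"
        unfolding Q_def using d bd fin sub[of "S - T"]
        by (intro mult_left_mono sum_le_of_weak_type p) auto
      finally show False
        using 1 d big sum.subset_diff[OF T(1) fin, of "\<lambda>n. a n * b n"] by linarith
    qed
  qed
qed

subsection \<open>Almost greedy bases of quasi-normed spaces\<close>

text \<open>The constant \<open>\<kappa>\<close> takes the place of \<open>1\<close> in the triangle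
  inequality. The module laws concern the whole ambient type, as does \<open>module.span\<close> in
  the definition of a basis.\<close>

locale quasi_normed_space =
  fixes X :: "('k::real_normed_field, 'v::ab_group_add) qspace" and \<kappa> :: real
  assumes module_smult: "module (smult X)"
    and zero_carrier: "0 \<in> carrier X"
    and add_carrier: "f \<in> carrier X \<Longrightarrow> g \<in> carrier X \<Longrightarrow> f + g \<in> carrier X"
    and smult_carrier: "f \<in> carrier X \<Longrightarrow> smult X a f \<in> carrier X"
    and qnorm_nonneg: "f \<in> carrier X \<Longrightarrow> 0 \<le> qnorm X f"
    and qnorm_smult: "f \<in> carrier X \<Longrightarrow> qnorm X (smult X a f) = norm a * qnorm X f"
    and qnorm_add: "f \<in> carrier X \<Longrightarrow> g \<in> carrier X \<Longrightarrow> qnorm X (f + g) \<le> \<kappa> * (qnorm X f + qnorm X g)"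
    and \<kappa>_pos: "0 < \<kappa>"
begin

sublocale vec: module "smult X"
  by (rule module_smult)

lemma uminus_eq: "- f = smult X (- 1) f"
  using vec.scale_minus_left[of 1 f] by simp

lemma uminus_carrier: "f \<in> carrier X \<Longrightarrow> - f \<in> carrier X"
  unfolding uminus_eq by (rule smult_carrier)

lemma diff_carrier: "f \<in> carrier X \<Longrightarrow> g \<in> carrier X \<Longrightarrow> f - g \<in> carrier X"
  using add_carrier[of f "- g"] by (simp add: uminus_carrier)

lemma sum_carrier: "(\<And>i. i \<in> A \<Longrightarrow> f i \<in> carrier X) \<Longrightarrow> sum f A \<in> carrier X"
  by (induction A rule: infinite_finite_induct) (auto simp: zero_carrier add_carrier)

lemma qnorm_uminus: "f \<in> carrier X \<Longrightarrow> qnorm X (- f) = qnorm X f"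
  unfolding uminus_eq by (subst qnorm_smult) simp_all

lemma qnorm_zero: "qnorm X 0 = 0"
  using qnorm_smult[OF zero_carrier, of 0] by simp

lemma qnorm_diff:
  "f \<in> carrier X \<Longrightarrow> g \<in> carrier X \<Longrightarrow> qnorm X (f - g) \<le> \<kappa> * (qnorm X f + qnorm X g)"
  using qnorm_add[of f "- g"] by (simp add: uminus_carrier qnorm_uminus)

lemma linear_functional_zero: "linear_functional X \<phi> \<Longrightarrow> \<phi> 0 = 0"
  
  using zero_carrier add_cancel_right_right[of "\<phi> 0" "\<phi> 0"] unfolding linear_functional_def
  by fastforce

lemma linear_functional_diff:
  assumes "linear_functional X \<phi>" "f \<in> carrier X" "g \<in> carrier X"
  shows "\<phi> (f - g) = \<phi> f - \<phi> g"
proof -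
  have "\<phi> (f - g + g) = \<phi> (f - g) + \<phi> g"
    using assms diff_carrier[of f g] unfolding linear_functional_def by blast
  then show ?thesis
    by simp
qed

lemma linear_functional_sum:
  assumes "linear_functional X \<phi>" "\<And>i. i \<in> A \<Longrightarrow> f i \<in> carrier X"
  shows "\<phi> (sum f A) = (\<Sum>i\<in>A. \<phi> (f i))"
  using assms(2)
proof (induction A rule: infinite_finite_induct)
  case (insert i A)
  then show ?case
    using assms(1) sum_carrier[of A f] by (simp add: linear_functional_def)
qed (simp_all add: linear_functional_zero[OF assms(1)])

lemma linear_functional_combination:
  assumes "linear_functional X \<phi>" "\<And>i. i \<in> A \<Longrightarrow> f i \<in> carrier X"
  shows "\<phi> (\<Sum>i\<in>A. smult X (a i) (f i)) = (\<Sum>i\<in>A. a i * \<phi> (f i))"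
  using assms
  by (subst linear_functional_sum) (auto simp: smult_carrier linear_functional_def intro!: sum.cong)

end

text \<open>One constant \<open>K\<close> serves for all bounds in the definition of an almost
  greedy basis, and the infimum is replaced by the estimate against each single competitor
  \<open>A\<close>.\<close>

locale almost_greedy_space = quasi_normed_space X \<kappa>
  for X :: "('k::real_normed_field, 'v::ab_group_add) qspace" and \<kappa> +
  fixes x :: "nat \<Rightarrow> 'v" and x' :: "nat \<Rightarrow> 'v \<Rightarrow> 'k" and K :: real
  assumes K: "1 \<le> K"
    and x_carrier: "x n \<in> carrier X"
    and qnorm_x: "qnorm X (x n) \<le> K"
    and dense_span: "f \<in> carrier X \<Longrightarrow> 0 < r \<Longrightarrow> \<exists>g\<in>module.span (smult X) (range x). qnorm X (f - g) < r"
    and linear_x': "linear_functional X (x' n)"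
    and norm_x': "f \<in> carrier X \<Longrightarrow> norm (x' n f) \<le> K * qnorm X f"
    and biorthogonal: "x' n (x k) = (if n = k then 1 else 0)"
    and almost_greedy: "f \<in> carrier X \<Longrightarrow> finite A \<Longrightarrow> card A \<le> m \<Longrightarrow>
      qnorm X (f - greedy_approx X x x' m f) \<le> K * qnorm X (f - coord_proj X x x' A f)"

lemma (in quasi_normed_space) almost_greedy_spaceE:
  assumes "has_almost_greedy_basis X"
  obtains x x' K where "almost_greedy_space X \<kappa> x x' K"
proof -
  obtain x x' C where basis: "basis_with_dual X x x'" and
    C: "\<And>f m. f \<in> carrier X \<Longrightarrow> qnorm X (f - greedy_approx X x x' m f) \<le>
          C * (INF A\<in>{A. finite A \<and> card A \<le> m}. qnorm X (f - coord_proj X x x' A f))"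
    using assms unfolding has_almost_greedy_basis_def almost_greedy_basis_def by blast
  obtain C1 C2 where C1: "\<And>n. qnorm X (x n) \<le> C1"
    and C2: "\<And>n f. f \<in> carrier X \<Longrightarrow> norm (x' n f) \<le> C2 * qnorm X f"
    using basis unfolding basis_with_dual_def by blast
  have x: "x n \<in> carrier X" for n
    using basis unfolding basis_with_dual_def by blast
  define K where "K = max 1 (max C (max C1 C2))"
  have K: "1 \<le> K" "C \<le> K" "C1 \<le> K" "C2 \<le> K"
    by (auto simp: K_def)
  have "almost_greedy_space X \<kappa> x x' K"
  proof (intro almost_greedy_space.intro almost_greedy_space_axioms.intro quasi_normed_space_axioms)
    fix f and A :: "nat set" and m :: nat
    assume f: "f \<in> carrier X" and A: "finite A" "card A \<le> m"
    let ?I = "INF A\<in>{A. finite A \<and> card A \<le> m}. qnorm X (f - coord_proj X x x' A f)"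
    have nonneg: "0 \<le> qnorm X (f - coord_proj X x x' A f)" for A :: "nat set"
      using f x by (auto intro!: qnorm_nonneg diff_carrier sum_carrier smult_carrier simp: coord_proj_def)
    have "?I \<le> qnorm X (f - coord_proj X x x' A f)"
      using A nonneg by (intro cINF_lower bdd_belowI2[where m = 0]) auto
    \<comment> \<open>The constant \<open>C\<close> may be negative; nonnegativity of the infimum is
      what allows the passage from \<open>C\<close> to \<open>K\<close>.\<close>
    moreover have "0 \<le> ?I"
      using A nonneg by (intro cINF_greatest) auto
    ultimately have "C * ?I \<le> K * qnorm X (f - coord_proj X x x' A f)"
      using K nonneg by (intro mult_mono) auto
    then show "qnorm X (f - greedy_approx X x x' m f) \<le> K * qnorm X (f - coord_proj X x x' A f)"
      using C[OF f, of m] by linarith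
  next
    fix n and f assume f: "f \<in> carrier X"
    show "norm (x' n f) \<le> K * qnorm X f"
      using C2[OF f, of n] mult_right_mono[OF K(4) qnorm_nonneg[OF f]] by linarith
  next
    show "qnorm X (x n) \<le> K" for n
      using C1[of n] K by linarith
  qed (use K x basis in \<open>auto simp: basis_with_dual_def\<close>)
  then show thesis
    by (rule that)
qed

section \<open>Existence and uniqueness of greedy sets\<close>

lemma greedy_set_eqI:
  assumes "finite A" "card A = m"
    and greedy: "\<And>i j. i \<in> A \<Longrightarrow> j \<notin> A \<Longrightarrow>
      norm (x' i f) > norm (x' j f) \<or> (norm (x' i f) = norm (x' j f) \<and> i < j)"
  shows "greedy_set x' m f = A"
  unfolding greedy_set_def
proof (rule the_equality)
  show "B = A" if B: "finite B \<and> card B = m \<and> (\<forall>i\<in>B. \<forall>j. j \<notin> B \<longrightarrow>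
      norm (x' i f) > norm (x' j f) \<or> (norm (x' i f) = norm (x' j f) \<and> i < j))" for B
  proof (rule ccontr)
    assume ne: "B \<noteq> A"
    \<comment> \<open>Two distinct sets of equal size each contain an index missing from the other;
      each of these indices would have to precede the other in the greedy order.\<close>
    have "\<not> A \<subseteq> B" "\<not> B \<subseteq> A"
      using ne B assms(1,2) card_subset_eq[of A B] card_subset_eq[of B A] by auto
    then obtain i j where "i \<in> A" "i \<notin> B" "j \<in> B" "j \<notin> A"
      by blast
    then show False
      using greedy[of i j] B by force
  qed
qed (use assms in auto)

text \<open>The set is built one index at a time: the next one has the largest modulus outside the
  current set and, among those, the least index. A largest modulus exists since only finitely many
  coefficients are nonzero.\<close>

lemma greedy_set_exists:
  fixes x' :: "nat \<Rightarrow> 'v \<Rightarrow> 'k::real_normed_field"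
  assumes "finite {n. x' n f \<noteq> 0}"
  shows "\<exists>A. finite A \<and> card A = m \<and> (\<forall>i\<in>A. \<forall>j. j \<notin> A \<longrightarrow>
      norm (x' i f) > norm (x' j f) \<or> (norm (x' i f) = norm (x' j f) \<and> i < j))"
proof (induction m)
  case 0
  show ?case
    by (intro exI[of _ "{}"]) auto
next
  case (Suc m)
  then obtain A where A: "finite A" "card A = m" and greedy: "\<And>i j. i \<in> A \<Longrightarrow> j \<notin> A \<Longrightarrow>
      norm (x' i f) > norm (x' j f) \<or> (norm (x' i f) = norm (x' j f) \<and> i < j)"
    by blast
  have "\<exists>k. k \<notin> A \<and> (\<forall>j. j \<notin> A \<longrightarrow> norm (x' j f) \<le> norm (x' k f))"
  proof (cases "{n. x' n f \<noteq> 0} - A = {}")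
    case True
    \<comment> \<open>All remaining coefficients vanish, so any new index attains the maximum
      \<open>0\<close>.\<close>
    obtain k where "k \<notin> A"
      using A(1) ex_new_if_finite infinite_UNIV_nat by blast
    moreover have "x' j f = 0" if "j \<notin> A" for j
      using True that by blast
    ultimately show ?thesis
      by (intro exI[of _ k]) simp
  next
    case False
    define M where "M = Max ((\<lambda>n. norm (x' n f)) ` ({n. x' n f \<noteq> 0} - A))"
    have "M \<in> (\<lambda>n. norm (x' n f)) ` ({n. x' n f \<noteq> 0} - A)"
      unfolding M_def using assms False by (intro Max_in) auto
    then obtain k where k: "k \<notin> A" "M = norm (x' k f)"
      by auto
    have "norm (x' j f) \<le> norm (x' k f)" if "j \<notin> A" for j
    proof (cases "x' j f = 0")
      case False
      then show ?thesis
        unfolding k(2)[symmetric] M_def using assms that by (intro Max_ge) auto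
    qed simp
    with k(1) show ?thesis
      by blast
  qed
  then obtain k0 where k0: "k0 \<notin> A" "\<And>j. j \<notin> A \<Longrightarrow> norm (x' j f) \<le> norm (x' k0 f)"
    by blast
  define k where "k = (LEAST k. k \<notin> A \<and> norm (x' k f) = norm (x' k0 f))"
  have k: "k \<notin> A \<and> norm (x' k f) = norm (x' k0 f)"
    unfolding k_def by (rule LeastI[of _ k0]) (simp add: k0)
  have least: "k \<le> j" if "j \<notin> A" "norm (x' j f) = norm (x' k0 f)" for j
    unfolding k_def using that by (intro Least_le) auto
  show ?case
  proof (intro exI[of _ "insert k A"] conjI ballI allI impI)
    fix i j assume "i \<in> insert k A" "j \<notin> insert k A"
    then show "norm (x' i f) > norm (x' j f) \<or> (norm (x' i f) = norm (x' j f) \<and> i < j)"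
      using greedy[of i j] k k0(2)[of j] least[of j] by (cases "i = k") force+
  qed (use A k in auto)
qed

section \<open>Strong democracy of almost greedy bases\<close>

context almost_greedy_space
begin

lemma combination_carrier: "(\<Sum>n\<in>B. smult X (u n) (x n)) \<in> carrier X"
  by (intro sum_carrier smult_carrier x_carrier)

lemma x'_combination:
  "finite B \<Longrightarrow> x' n (\<Sum>k\<in>B. smult X (u k) (x k)) = (if n \<in> B then u n else 0)"
  by (subst linear_functional_combination[OF linear_x' x_carrier])
    (simp add: biorthogonal if_distrib cong: if_cong)

lemma x'_add: "f \<in> carrier X \<Longrightarrow> g \<in> carrier X \<Longrightarrow> x' n (f + g) = x' n f + x' n g"
  using linear_x' unfolding linear_functional_def by blast

lemma x'_diff: "f \<in> carrier X \<Longrightarrow> g \<in> carrier X \<Longrightarrow> x' n (f - g) = x' n f - x' n g"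
  by (rule linear_functional_diff[OF linear_x'])

lemma finite_combination_approx:
  assumes "f \<in> carrier X" "0 < r"
  obtains T u where "finite T" "qnorm X (f - (\<Sum>n\<in>T. smult X (u n) (x n))) < r"
proof -
  obtain g where g: "g \<in> module.span (smult X) (range x)" "qnorm X (f - g) < r"
    using dense_span[OF assms] by blast
  from g(1) obtain T u where T: "finite T" "T \<subseteq> range x" "g = (\<Sum>v\<in>T. smult X (u v) v)"
    unfolding vec.span_explicit by blast
  \<comment> \<open>Biorthogonality makes \<open>x\<close> injective, so a combination of vectors in
    its range can be indexed by natural numbers.\<close>
  have "inj x"
    by (rule injI) (metis biorthogonal zero_neq_one)
  moreover obtain S where S: "T = x ` S" "finite S"
    using T finite_subset_image by metis
  ultimately have "g = (\<Sum>n\<in>S. smult X (u (x n)) (x n))"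
    using T(3) by (simp add: sum.reindex inj_on_subset)
  then show thesis
    using that[of S "u \<circ> x"] S(2) g(2) by simp
qed

text \<open>In the next two lemmas, almost greediness is applied to a vector perturbed by a sum of basis
  vectors outside its support: the projection that removes one part competes with the greedy one,
  which removes the other.\<close>

lemma democratic:
  assumes "finite A" "finite B" "A \<inter> B = {}" "card B \<le> card A"
    and u: "\<And>n. n \<in> B \<Longrightarrow> norm (u n) \<le> 1"
  shows "qnorm X (\<Sum>n\<in>B. smult X (u n) (x n)) \<le> 2 * K * qnorm X (\<Sum>n\<in>A. smult X 1 (x n))"
proof -
  \<comment> \<open>The coefficient \<open>2\<close> exceeds every \<open>norm (u n)\<close>, so
    \<open>A\<close> is the greedy set of \<open>h\<close>. The greedy residual is then the sum over
    \<open>B\<close>, while the competitor \<open>B\<close> leaves twice the sum over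
    \<open>A\<close>; this gives the factor \<open>2 * K\<close>.\<close>
  define w where "w n = (if n \<in> A then 2 else u n)" for n
  define h where "h = (\<Sum>n\<in>A \<union> B. smult X (w n) (x n))"
  have h: "h \<in> carrier X"
    unfolding h_def by (rule combination_carrier)
  have coeff: "x' n h = (if n \<in> A \<union> B then w n else 0)" for n
    unfolding h_def using assms by (intro x'_combination) auto
  have "greedy_set x' (card A) h = A"
    using assms(1)
  proof (rule greedy_set_eqI)
    show "norm (x' i h) > norm (x' j h) \<or> (norm (x' i h) = norm (x' j h) \<and> i < j)"
      if "i \<in> A" "j \<notin> A" for i j
      using that u[of j] by (auto simp: coeff w_def)
  qed simp
  then have "greedy_approx X x x' (card A) h = (\<Sum>n\<in>A. smult X (w n) (x n))"
    by (simp add: greedy_approx_def coord_proj_def coeff)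
  moreover have h_split: "h = (\<Sum>n\<in>A. smult X (w n) (x n)) + (\<Sum>n\<in>B. smult X (w n) (x n))"
    unfolding h_def using assms by (intro sum.union_disjoint)
  moreover have "(\<Sum>n\<in>B. smult X (w n) (x n)) = (\<Sum>n\<in>B. smult X (u n) (x n))"
    using assms(3) by (intro sum.cong) (auto simp: w_def)
  ultimately have "h - greedy_approx X x x' (card A) h = (\<Sum>n\<in>B. smult X (u n) (x n))"
    by (metis add_diff_cancel_left')
  moreover have "h - coord_proj X x x' B h = smult X 2 (\<Sum>n\<in>A. smult X 1 (x n))"
  proof -
    have "coord_proj X x x' B h = (\<Sum>n\<in>B. smult X (w n) (x n))"
      by (simp add: coord_proj_def coeff)
    moreover have "(\<Sum>n\<in>A. smult X (w n) (x n)) = smult X 2 (\<Sum>n\<in>A. smult X 1 (x n))"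
      by (simp add: w_def vec.scale_sum_right)
    ultimately show ?thesis
      using h_split by (metis add_diff_cancel_right')
  qed
  ultimately show ?thesis
    using almost_greedy[OF h assms(2,4)] qnorm_smult[OF combination_carrier, of 2 "\<lambda>_. 1" A]
    by simp
qed

lemma qnorm_fresh_sum_le:
  assumes T: "finite T" and g: "g = (\<Sum>n\<in>T. smult X (u n) (x n))"
    and A: "finite A" "\<And>n. n \<in> A \<Longrightarrow> t \<le> norm (x' n g)"
    and B: "finite B" "card B = card A" "B \<inter> (A \<union> T) = {}" and t: "0 < t"
  shows "t * qnorm X (\<Sum>n\<in>B. smult X 1 (x n)) \<le> 4 * \<kappa> * K * qnorm X g"
proof -
  let ?m = "card A"
  \<comment> \<open>The coefficients \<open>t / 2\<close> on \<open>B\<close> lie below the level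
    \<open>t\<close>, so adding \<open>b\<close> to \<open>g\<close> does not change the greedy set
    of size \<open>card A\<close>.\<close>
  define b where "b = smult X (of_real (t / 2)) (\<Sum>n\<in>B. smult X 1 (x n))"
  have b_eq: "b = (\<Sum>n\<in>B. smult X (of_real (t / 2)) (x n))"
    unfolding b_def by (simp add: vec.scale_sum_right)
  have carr: "g \<in> carrier X" "b \<in> carrier X"
    unfolding g b_eq by (rule combination_carrier)+
  define h where "h = g + b"
  have h: "h \<in> carrier X"
    unfolding h_def using carr by (rule add_carrier)
  have g_coeff: "x' n g = (if n \<in> T then u n else 0)" for n
    unfolding g using T by (rule x'_combination)
  have h_coeff: "x' n h = (if n \<in> B then of_real (t / 2) else x' n g)" for n
    unfolding h_def x'_add[OF carr] using B(1,3)
    by (auto simp: b_eq x'_combination g_coeff)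
  have "finite {n. x' n g \<noteq> 0}"
    by (rule finite_subset[OF _ T]) (auto simp: g_coeff)
  then obtain D where D: "finite D" "card D = ?m" and greedy: "\<And>i j. i \<in> D \<Longrightarrow> j \<notin> D \<Longrightarrow>
      norm (x' i g) > norm (x' j g) \<or> (norm (x' i g) = norm (x' j g) \<and> i < j)"
    using greedy_set_exists[of x' g ?m] by blast
  \<comment> \<open>\<open>A\<close> supplies \<open>card A\<close> indices with coefficients of
    modulus at least \<open>t\<close>; were some index of \<open>D\<close> below this level, an
    index of \<open>A\<close> outside \<open>D\<close> would beat it.\<close>
  have D_large: "t \<le> norm (x' i g)" if "i \<in> D" for i
  proof (rule ccontr)
    assume small: "\<not> ?thesis"
    then have "i \<notin> A"
      using A(2) by auto
    then have "\<not> A \<subseteq> D"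
      using that D card_subset_eq[OF D(1), of A] by auto
    then obtain j where "j \<in> A" "j \<notin> D"
      by blast
    then show False
      using greedy[OF that, of j] A(2)[of j] small by auto
  qed
  \<comment> \<open>\<open>B\<close> avoids the support \<open>T\<close> of \<open>g\<close>,
    whereas the coefficients of \<open>g\<close> on \<open>D\<close> have modulus at least
    \<open>t > 0\<close>.\<close>
  have DB: "i \<notin> B" if "i \<in> D" for i
    using D_large[OF that] t B(3) by (auto simp: g_coeff split: if_splits)
  have "greedy_set x' ?m g = D"
    using D greedy by (rule greedy_set_eqI)
  then have g_approx: "greedy_approx X x x' ?m g = coord_proj X x x' D g"
    by (simp add: greedy_approx_def)
  have "greedy_set x' ?m h = D"
    using D
  proof (rule greedy_set_eqI)
    show "norm (x' i h) > norm (x' j h) \<or> (norm (x' i h) = norm (x' j h) \<and> i < j)"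
      if "i \<in> D" "j \<notin> D" for i j
      using that D_large[of i] DB[of i] t greedy[of i j] by (auto simp: h_coeff)
  qed
  moreover have "coord_proj X x x' D h = coord_proj X x x' D g"
    unfolding coord_proj_def using DB by (intro sum.cong) (auto simp: h_coeff)
  ultimately have h_approx: "greedy_approx X x x' ?m h = coord_proj X x x' D g"
    by (simp add: greedy_approx_def)
  have D_carr: "coord_proj X x x' D g \<in> carrier X"
    unfolding coord_proj_def by (rule combination_carrier)
  \<comment> \<open>For \<open>g\<close> the competitor is the empty set; for \<open>h\<close> it is
    \<open>B\<close>, which leaves exactly \<open>g\<close>. The two greedy residuals differ by
    \<open>b\<close>.\<close>
  have "qnorm X (g - coord_proj X x x' D g) \<le> K * qnorm X g"
    using almost_greedy[OF carr(1), of "{}" ?m] by (simp add: g_approx coord_proj_def)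
  moreover have "coord_proj X x x' B h = b"
    unfolding coord_proj_def b_eq by (intro sum.cong) (auto simp: h_coeff)
  then have "h - coord_proj X x x' B h = g"
    by (simp add: h_def)
  then have "qnorm X (h - coord_proj X x x' D g) \<le> K * qnorm X g"
    using almost_greedy[OF h B(1), of ?m] B(2) by (simp add: h_approx)
  moreover have "b = (h - coord_proj X x x' D g) - (g - coord_proj X x x' D g)"
    by (simp add: h_def)
  ultimately have "qnorm X b \<le> \<kappa> * (K * qnorm X g + K * qnorm X g)"
    using qnorm_diff[OF diff_carrier[OF h D_carr] diff_carrier[OF carr(1) D_carr]] \<kappa>_pos
    by (smt (verit) mult_left_mono)
  moreover have "qnorm X b = t / 2 * qnorm X (\<Sum>n\<in>B. smult X 1 (x n))"
    unfolding b_def using t by (simp add: qnorm_smult combination_carrier del: vec.scale_one)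
  ultimately show ?thesis
    by (simp add: algebra_simps)
qed

text \<open>The product of the factors met in \<open>qnorm_combination_le\<close>:
  \<open>2 * K\<close> from \<open>democratic\<close>, \<open>2\<close> from lowering
  \<open>t\<close> to \<open>t / 2\<close>, \<open>4 * \<kappa> * K\<close> from
  \<open>qnorm_fresh_sum_le\<close>, and \<open>2 * \<kappa>\<close> from replacing \<open>f\<close>
  by a finite combination.\<close>

definition "greedy_const = 32 * \<kappa>\<^sup>2 * K\<^sup>2"

text \<open>The strong form of democracy. A finite combination \<open>g\<close> close to
  \<open>f\<close> keeps coefficients of modulus at least \<open>t / 2\<close> on \<open>A\<close>.
  The sum over \<open>B\<close> is compared with the plain sum over a fresh set \<open>E\<close> of
  size \<open>card A\<close>, and this one with \<open>g\<close>. The detour through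
  \<open>E\<close> allows \<open>A\<close> and \<open>B\<close> to overlap.\<close>

lemma qnorm_combination_le:
  assumes f: "f \<in> carrier X"
    and A: "finite A" "\<And>n. n \<in> A \<Longrightarrow> t \<le> norm (x' n f)"
    and B: "finite B" "card B \<le> card A" "\<And>n. n \<in> B \<Longrightarrow> norm (v n) \<le> 1" and t: "0 \<le> t"
  shows "t * qnorm X (\<Sum>n\<in>B. smult X (v n) (x n)) \<le> greedy_const * qnorm X f"
proof (cases "t = 0 \<or> A = {}")
  case True
  then show ?thesis
    using A B qnorm_nonneg[OF f] by (auto simp: greedy_const_def qnorm_zero)
next
  case False
  then have t: "0 < t" and "A \<noteq> {}"
    using t by auto
  then obtain a where a: "a \<in> A"
    by blast
  have "t \<le> K * qnorm X f"
    using A(2)[OF a] norm_x'[OF f, of a] by linarith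
  then have "0 < K * qnorm X f"
    using t by linarith
  then have f_pos: "0 < qnorm X f"
    using K by (simp add: zero_less_mult_iff)
  \<comment> \<open>\<open>r \<le> qnorm X f\<close> bounds \<open>qnorm X g\<close> by
    \<open>2 * \<kappa> * qnorm X f\<close>, and \<open>K * r \<le> t / 2\<close> keeps the change
    of each coefficient within \<open>t / 2\<close>.\<close>
  define r where "r = min (qnorm X f) (t / (2 * K))"
  have r: "0 < r" "r \<le> qnorm X f" "K * r \<le> t / 2"
    using f_pos t K by (auto simp: r_def min_def field_simps)
  obtain T u where T: "finite T" and fg: "qnorm X (f - (\<Sum>n\<in>T. smult X (u n) (x n))) < r"
    using finite_combination_approx[OF f r(1)] by blast
  define g where "g = (\<Sum>n\<in>T. smult X (u n) (x n))"
  have g: "g \<in> carrier X"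
    unfolding g_def by (rule combination_carrier)
  have g_le: "qnorm X g \<le> 2 * \<kappa> * qnorm X f"
  proof -
    have "qnorm X g \<le> \<kappa> * (qnorm X f + qnorm X (f - g))"
      using qnorm_diff[OF f diff_carrier[OF f g]] by simp
    also have "\<dots> \<le> \<kappa> * (qnorm X f + qnorm X f)"
      using fg r \<kappa>_pos by (intro mult_left_mono) (auto simp: g_def)
    finally show ?thesis
      by simp
  qed
  have g_large: "t / 2 \<le> norm (x' n g)" if "n \<in> A" for n
  proof -
    have "norm (x' n f - x' n g) \<le> K * qnorm X (f - g)"
      using norm_x'[OF diff_carrier[OF f g], of n] by (simp add: x'_diff f g)
    also have "\<dots> \<le> K * r"
      using fg K by (intro mult_left_mono) (auto simp: g_def)
    finally show ?thesis
      using A(2)[OF that] r norm_triangle_ineq2[of "x' n f" "x' n g"] by linarith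
  qed
  have "infinite (UNIV - (A \<union> B \<union> T))"
    using A B T by (intro Diff_infinite_finite) auto
  then obtain E where E: "E \<subseteq> UNIV - (A \<union> B \<union> T)" "finite E" "card E = card A"
    using infinite_arbitrarily_large by metis
  have "t * qnorm X (\<Sum>n\<in>B. smult X (v n) (x n)) \<le> t * (2 * K * qnorm X (\<Sum>n\<in>E. smult X 1 (x n)))"
    using E B t by (intro mult_left_mono democratic) auto
  also have "\<dots> = 4 * K * (t / 2 * qnorm X (\<Sum>n\<in>E. smult X 1 (x n)))"
    by simp
  also have "\<dots> \<le> 4 * K * (4 * \<kappa> * K * qnorm X g)"
  proof (intro mult_left_mono)
    show "t / 2 * qnorm X (\<Sum>n\<in>E. smult X 1 (x n)) \<le> 4 * \<kappa> * K * qnorm X g"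
      by (rule qnorm_fresh_sum_le[OF T g_def A(1) g_large E(2,3)]) (use E t in auto)
  qed (use K in auto)
  also have "\<dots> \<le> 4 * K * (4 * \<kappa> * K * (2 * \<kappa> * qnorm X f))"
    using g_le K \<kappa>_pos by (intro mult_left_mono) auto
  also have "\<dots> = greedy_const * qnorm X f"
    by (simp add: greedy_const_def power2_eq_square)
  finally show ?thesis .
qed

end

subsection \<open>Spaces with coordinates\<close>

text \<open>Markov's inequality for the counting measure.\<close>

lemma weak_type_of_sum:
  fixes a :: "'a \<Rightarrow> real"
  assumes "finite F" "(\<Sum>n\<in>F. a n powr p) \<le> M" "0 < t" "0 \<le> p"
  shows "t powr p * card {n\<in>F. t \<le> a n} \<le> M"
proof -
  have "t powr p * card {n\<in>F. t \<le> a n} = (\<Sum>n\<in>{n\<in>F. t \<le> a n}. t powr p)"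
    by simp
  also have "\<dots> \<le> (\<Sum>n\<in>{n\<in>F. t \<le> a n}. a n powr p)"
    using assms by (intro sum_mono powr_mono2) auto
  also have "\<dots> \<le> (\<Sum>n\<in>F. a n powr p)"
    using assms by (intro sum_mono2) auto
  finally show ?thesis
    using assms(2) by linarith
qed

lemma card_le_fibres:
  assumes "finite A" "\<And>y. y \<in> g ` A \<Longrightarrow> real (card {x\<in>A. g x = y}) \<le> N"
  shows "real (card A) \<le> N * card (g ` A)"
proof -
  have "real (card A) = (\<Sum>y\<in>g ` A. real (card {x\<in>A. g x = y}))"
    using sum.image_gen[OF assms(1), of "\<lambda>_. 1::real" g] by simp
  also have "\<dots> \<le> (\<Sum>y\<in>g ` A. N)"
    using assms(2) by (rule sum_mono)
  finally show ?thesis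
    by (simp add: mult.commute)
qed

text \<open>The common framework for all spaces of the theorem, with \<open>p\<close> the larger
  exponent. By \<open>sum_c_le\<close> the coordinates map the space boundedly into
  \<open>\<ell>\<^sub>p\<close>; this also covers \<open>\<ell>\<^sub>r\<close> for
  \<open>r \<le> p\<close>. The index type is left open so that pairs and disjoint sums can serve as
  indices.\<close>

locale coordinate_space = quasi_normed_space X \<kappa>
  for X :: "('k::real_normed_field, 'v::ab_group_add) qspace" and \<kappa> +
  fixes I :: "'i set" and c :: "'i \<Rightarrow> 'v \<Rightarrow> 'k" and e :: "'i \<Rightarrow> 'v" and p L :: real
  assumes p_pos: "0 < p" and L_pos: "0 < L"
    and linear_c: "i \<in> I \<Longrightarrow> linear_functional X (c i)"
    and e_carrier: "i \<in> I \<Longrightarrow> e i \<in> carrier X"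
    and qnorm_e: "i \<in> I \<Longrightarrow> qnorm X (e i) \<le> 1"
    and c_e: "i \<in> I \<Longrightarrow> j \<in> I \<Longrightarrow> c i (e j) = (if i = j then 1 else 0)"
    and sum_c_le: "finite F \<Longrightarrow> F \<subseteq> I \<Longrightarrow> f \<in> carrier X \<Longrightarrow>
      (\<Sum>i\<in>F. norm (c i f) powr p) \<le> L * qnorm X f powr p"
    and dense_e: "f \<in> carrier X \<Longrightarrow> 0 < r \<Longrightarrow>
      \<exists>F. finite F \<and> F \<subseteq> I \<and> qnorm X (f - (\<Sum>i\<in>F. smult X (c i f) (e i))) < r"

text \<open>Two one-sided traits of a copy of \<open>\<ell>\<^sub>r\<close> of dimension
  \<open>card J\<close>: an upper bound for subsums of its units, and a lower bound for the
  quasi-norm of every vector of the space, not only of those supported on \<open>J\<close>. The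
  former is exploited for the exponent \<open>p\<close>, the latter for \<open>q\<close>.\<close>

definition lr_block ::
    "('k::real_normed_field, 'v::ab_group_add) qspace \<Rightarrow> ('i \<Rightarrow> 'v \<Rightarrow> 'k) \<Rightarrow> ('i \<Rightarrow> 'v) \<Rightarrow> real \<Rightarrow> 'i set \<Rightarrow> bool" where
  "lr_block X c e r J \<longleftrightarrow> finite J \<and>
    (\<forall>S\<subseteq>J. qnorm X (\<Sum>i\<in>S. e i) \<le> card J powr (1 / r)) \<and>
    (\<forall>f\<in>carrier X. (\<Sum>i\<in>J. norm (c i f) powr r) \<le> qnorm X f powr r)"

section \<open>Matching basis vectors with unit vectors\<close>

locale coordinate_almost_greedy_space =
  coordinate_space X \<kappa> I c e p L + almost_greedy_space X \<kappa> x x' K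
  for X :: "('k::real_normed_field, 'v::ab_group_add) qspace" and \<kappa>
    and I :: "'i set" and c e p L x x' K +
  assumes p_less_1: "p < 1"
begin

text \<open>The bound for a single functional \<open>c i\<close> that results from
  \<open>sum_c_le\<close>.\<close>

definition "L1 = L powr (1 / p)"

lemma L1_pos: "0 < L1"
  using L_pos by (simp add: L1_def)

lemma norm_c:
  assumes "i \<in> I" "f \<in> carrier X"
  shows "norm (c i f) \<le> L1 * qnorm X f"
proof -
  have "norm (c i f) powr p \<le> L * qnorm X f powr p"
    using sum_c_le[of "{i}" f] assms by simp
  then have "(norm (c i f) powr p) powr (1 / p) \<le> (L * qnorm X f powr p) powr (1 / p)"
    using p_pos by (intro powr_mono2) auto
  then show ?thesis
    using p_pos L_pos qnorm_nonneg[OF assms(2)] by (simp add: powr_mult powr_powr L1_def)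
qed

lemma c_combination:
  assumes "i \<in> I"
  shows "c i (\<Sum>n\<in>B. smult X (u n) (x n)) = (\<Sum>n\<in>B. u n * c i (x n))"
  by (rule linear_functional_combination[OF linear_c[OF assms] x_carrier])

text \<open>\<open>exists_jointly_large\<close> is applied to the expansion of
  \<open>x' n (x n) = 1\<close> in unit vectors. The bounds \<open>U\<close> and
  \<open>L * K powr p\<close> do not depend on \<open>n\<close>, which makes \<open>d\<close>
  uniform.\<close>

lemma exists_large_coordinate:
  "\<exists>d>0. \<forall>n. \<exists>i\<in>I. d \<le> norm (c i (x n)) \<and> d \<le> norm (x' n (e i))"
proof -
  define U where "U = max (L1 * K) K"
  show ?thesis
  proof (rule exists_jointly_large[OF p_pos p_less_1, where U = U and M = "L * K powr p"])
    fix d :: real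
    assume d: "0 < d" "\<And>(S :: 'i set) a b. finite S \<Longrightarrow>
      (\<And>n. n \<in> S \<Longrightarrow> 0 \<le> a n \<and> a n \<le> U \<and> 0 \<le> b n \<and> b n \<le> U) \<Longrightarrow>
      (\<And>t. 0 < t \<Longrightarrow> t powr p * card {n\<in>S. t \<le> a n} \<le> L * K powr p) \<Longrightarrow>
      1 / 2 \<le> (\<Sum>n\<in>S. a n * b n) \<Longrightarrow> \<exists>n\<in>S. d \<le> a n \<and> d \<le> b n"
    have "\<exists>i\<in>I. d \<le> norm (c i (x n)) \<and> d \<le> norm (x' n (e i))" for n
    proof -
      \<comment> \<open>An error of \<open>1 / (2 * K)\<close> moves the value of
        \<open>x' n\<close> by at most \<open>1 / 2\<close>, so the finite sum keeps modulus at
        least \<open>1 / 2\<close>.\<close>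
      obtain F where F: "finite F" "F \<subseteq> I"
        and approx: "qnorm X (x n - (\<Sum>i\<in>F. smult X (c i (x n)) (e i))) < 1 / (2 * K)"
        using dense_e[OF x_carrier, of "1 / (2 * K)" n] K by auto
      define y where "y = (\<Sum>i\<in>F. smult X (c i (x n)) (e i))"
      have y: "y \<in> carrier X"
        unfolding y_def using F e_carrier by (intro sum_carrier smult_carrier) auto
      have "norm (1 - x' n y) \<le> K * qnorm X (x n - y)"
        using norm_x'[OF diff_carrier[OF x_carrier y], of n n] by (simp add: x'_diff x_carrier y biorthogonal)
      also have "\<dots> \<le> K * (1 / (2 * K))"
        using approx K by (intro mult_left_mono) (auto simp: y_def)
      also have "\<dots> = 1 / 2"
        using K by simp
      finally have "1 / 2 \<le> norm (x' n y)"
        using norm_triangle_ineq2[of 1 "x' n y"] by simp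
      also have "x' n y = (\<Sum>i\<in>F. c i (x n) * x' n (e i))"
        unfolding y_def using F e_carrier by (intro linear_functional_combination[OF linear_x']) auto
      also have "norm \<dots> \<le> (\<Sum>i\<in>F. norm (c i (x n)) * norm (x' n (e i)))"
        by (intro order_trans[OF norm_sum]) (simp add: norm_mult)
      finally have "1 / 2 \<le> (\<Sum>i\<in>F. norm (c i (x n)) * norm (x' n (e i)))" .
      moreover have "norm (c i (x n)) \<le> U" if "i \<in> F" for i
      proof -
        have "norm (c i (x n)) \<le> L1 * qnorm X (x n)"
          using that F by (intro norm_c x_carrier) auto
        also have "\<dots> \<le> L1 * K"
          using L1_pos qnorm_x by (intro mult_left_mono) auto
        finally show ?thesis
          by (simp add: U_def)
      qed
      moreover have "norm (x' n (e i)) \<le> U" if "i \<in> F" for i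
      proof -
        have i: "i \<in> I"
          using F that by auto
        have "norm (x' n (e i)) \<le> K * qnorm X (e i)"
          using i by (intro norm_x' e_carrier)
        also have "\<dots> \<le> K * 1"
          using K qnorm_e[OF i] by (intro mult_left_mono) auto
        finally show ?thesis
          by (simp add: U_def)
      qed
      moreover have "t powr p * card {i\<in>F. t \<le> norm (c i (x n))} \<le> L * K powr p" if "0 < t" for t
      proof (rule weak_type_of_sum[OF F(1) _ that])
        have "(\<Sum>i\<in>F. norm (c i (x n)) powr p) \<le> L * qnorm X (x n) powr p"
          using F by (intro sum_c_le x_carrier)
        also have "\<dots> \<le> L * K powr p"
          using qnorm_x qnorm_nonneg[OF x_carrier] L_pos p_pos by (intro mult_left_mono powr_mono2) auto
        finally show "(\<Sum>i\<in>F. norm (c i (x n)) powr p) \<le> L * K powr p" .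
      qed (use p_pos in auto)
      ultimately show ?thesis
        using d(2)[OF F(1), of "\<lambda>i. norm (c i (x n))" "\<lambda>i. norm (x' n (e i))"] F(2) by auto
    qed
    with d(1) show ?thesis
      by blast
  qed
qed

lemma greedy_const_pos: "0 < greedy_const"
  using K \<kappa>_pos by (simp add: greedy_const_def)

text \<open>Weights \<open>v n\<close> of modulus \<open>1\<close> align the phases of the
  \<open>c i (x n)\<close>, so that \<open>c i\<close> of the weighted sum is at least
  \<open>card B * d\<close>. Strong democracy for \<open>e i\<close>, whose coefficients on
  \<open>B\<close> have modulus at least \<open>d\<close>, bounds the quasi-norm of that sum by
  \<open>greedy_const / d\<close>.\<close>

lemma card_large_le:
  assumes i: "i \<in> I" and d: "0 < d" and "finite B"
    and large: "\<And>n. n \<in> B \<Longrightarrow> d \<le> norm (c i (x n)) \<and> d \<le> norm (x' n (e i))"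
  shows "real (card B) \<le> L1 * greedy_const / d\<^sup>2"
proof -
  define v where "v n = of_real (norm (c i (x n))) / c i (x n)" for n
  have v: "norm (v n) \<le> 1" "v n * c i (x n) = of_real (norm (c i (x n)))" if "n \<in> B" for n
    using large[OF that] d by (auto simp: v_def norm_divide)
  let ?s = "\<Sum>n\<in>B. smult X (v n) (x n)"
  have "d * qnorm X ?s \<le> greedy_const * qnorm X (e i)"
    using assms v by (intro qnorm_combination_le[where A = B] e_carrier) auto
  also have "\<dots> \<le> greedy_const * 1"
    using greedy_const_pos qnorm_e[OF i] by (intro mult_left_mono) auto
  finally have s: "d * qnorm X ?s \<le> greedy_const"
    by simp
  have "real (card B) * d \<le> (\<Sum>n\<in>B. norm (c i (x n)))"
    using large by (intro sum_bounded_below) auto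
  also have "\<dots> = norm (of_real (\<Sum>n\<in>B. norm (c i (x n))) :: 'k)"
    unfolding norm_of_real by (rule sym, rule abs_of_nonneg, rule sum_nonneg) simp
  also have "of_real (\<Sum>n\<in>B. norm (c i (x n))) = c i ?s"
    unfolding c_combination[OF i] of_real_sum using v(2) by (intro sum.cong) auto
  also have "norm (c i ?s) \<le> L1 * qnorm X ?s"
    by (rule norm_c[OF i combination_carrier])
  finally have "real (card B) * d * d \<le> L1 * qnorm X ?s * d"
    using d by (intro mult_right_mono) auto
  also have "\<dots> = L1 * (d * qnorm X ?s)"
    by simp
  also have "\<dots> \<le> L1 * greedy_const"
    using s L1_pos by (intro mult_left_mono) auto
  finally show ?thesis
    using d by (simp add: field_simps power2_eq_square)
qed

text \<open>Each \<open>n\<close> is matched with some \<open>i n\<close>, with fibres bounded by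
  \<open>card_large_le\<close>, so \<open>A\<close> meets at least \<open>card A / N\<close> unit
  vectors. Some subsum \<open>s\<close> of the basis vectors in \<open>A\<close> has large
  coordinates at half of them, which bounds \<open>qnorm X s\<close> from below through
  \<open>sum_c_le\<close>; strong democracy bounds it from above by \<open>f\<close>.\<close>

lemma weak_type_coefficients:
  "\<exists>M>0. \<forall>f\<in>carrier X. \<forall>A t. finite A \<longrightarrow> 0 < t \<longrightarrow> (\<forall>n\<in>A. t \<le> norm (x' n f)) \<longrightarrow>
    t powr p * card A \<le> M * qnorm X f powr p"
proof -
  obtain d where d: "0 < d" "\<And>n. \<exists>i\<in>I. d \<le> norm (c i (x n)) \<and> d \<le> norm (x' n (e i))"
    using exists_large_coordinate by blast
  obtain i where i: "\<And>n. i n \<in> I" "\<And>n. d \<le> norm (c (i n) (x n))" "\<And>n. d \<le> norm (x' n (e (i n)))"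
    using d(2) by metis
  define N where "N = L1 * greedy_const / d\<^sup>2"
  have N: "0 < N"
    using d(1) L1_pos greedy_const_pos by (simp add: N_def)
  \<comment> \<open>\<open>2 * N\<close> accounts for the fibres and for the half lost on passing to
    a subsum; the other factors come from \<open>sum_c_le\<close> at level \<open>d / 2\<close> and
    from strong democracy raised to the power \<open>p\<close>.\<close>
  define M where "M = 2 * N * L * greedy_const powr p / (d / 2) powr p"
  have "t powr p * card A \<le> M * qnorm X f powr p"
    if f: "f \<in> carrier X" and A: "finite A" and t: "0 < t" and large: "\<forall>n\<in>A. t \<le> norm (x' n f)" for f A t
  proof -
    have "real (card {n\<in>A. i n = j}) \<le> N" if "j \<in> i ` A" for j
      unfolding N_def
    proof (rule card_large_le)
      show "d \<le> norm (c j (x n)) \<and> d \<le> norm (x' n (e j))" if "n \<in> {n\<in>A. i n = j}" for n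
        using that i(2,3)[of n] by simp
    qed (use A d(1) i(1) that in auto)
    then have card_A: "real (card A) \<le> N * card (i ` A)"
      by (rule card_le_fibres[OF A])
    have "\<exists>S\<subseteq>A. card (i ` A) \<le> 2 * card {j\<in>i ` A. d / 2 \<le> norm (\<Sum>n\<in>S. c j (x n))}"
      using A i(2) by (intro exists_subset_half_large) auto
    then obtain S where S: "S \<subseteq> A" "card (i ` A) \<le> 2 * card {j\<in>i ` A. d / 2 \<le> norm (\<Sum>n\<in>S. c j (x n))}"
      by blast
    define s where "s = (\<Sum>n\<in>S. smult X 1 (x n))"
    have s: "s \<in> carrier X"
      unfolding s_def by (rule combination_carrier)
    define H where "H = {j\<in>i ` A. d / 2 \<le> norm (c j s)}"
    have "{j\<in>i ` A. d / 2 \<le> norm (\<Sum>n\<in>S. c j (x n))} = H"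
      using i(1) unfolding H_def s_def by (intro Collect_cong) (auto simp: c_combination simp del: vec.scale_one)
    with S(2) have H: "real (card (i ` A)) \<le> 2 * real (card H)"
      by simp
    have lower: "(d / 2) powr p * card H \<le> L * qnorm X s powr p"
      unfolding H_def using A i(1) s d(1) p_pos by (intro weak_type_of_sum sum_c_le) auto
    have "t * qnorm X s \<le> greedy_const * qnorm X f"
      unfolding s_def using f A S(1) t large
      by (intro qnorm_combination_le[where A = A]) (auto intro: finite_subset card_mono)
    then have "(t * qnorm X s) powr p \<le> (greedy_const * qnorm X f) powr p"
      using t qnorm_nonneg[OF s] p_pos by (intro powr_mono2) auto
    then have upper: "t powr p * qnorm X s powr p \<le> greedy_const powr p * qnorm X f powr p"
      using t qnorm_nonneg[OF s] qnorm_nonneg[OF f] greedy_const_pos by (simp add: powr_mult)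
    have "t powr p * (N * (2 * card H)) * (d / 2) powr p = 2 * N * (t powr p * ((d / 2) powr p * card H))"
      by simp
    also have "\<dots> \<le> 2 * N * (t powr p * (L * qnorm X s powr p))"
      using N lower by (intro mult_left_mono) auto
    also have "\<dots> = 2 * N * (L * (t powr p * qnorm X s powr p))"
      by simp
    also have "\<dots> \<le> 2 * N * (L * (greedy_const powr p * qnorm X f powr p))"
      using N L_pos upper by (intro mult_left_mono) auto
    finally have 1: "t powr p * (N * (2 * card H)) * (d / 2) powr p \<le>
        2 * N * (L * (greedy_const powr p * qnorm X f powr p))" .
    have "N * card (i ` A) \<le> N * (2 * card H)"
      using H N by (intro mult_left_mono) auto
    then have "real (card A) \<le> N * (2 * card H)"
      using card_A by linarith
    then have "t powr p * card A * (d / 2) powr p \<le> t powr p * (N * (2 * card H)) * (d / 2) powr p"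
      by (intro mult_left_mono mult_right_mono) auto
    with 1 have "t powr p * card A * (d / 2) powr p \<le> 2 * N * (L * (greedy_const powr p * qnorm X f powr p))"
      by linarith
    then show ?thesis
      using d(1) by (simp add: M_def pos_le_divide_eq mult.assoc)
  qed
  moreover have "0 < M"
    using N L_pos greedy_const_pos d(1) by (simp add: M_def)
  ultimately show ?thesis
    by blast
qed

text \<open>The converse matching, from unit vectors to basis vectors: \<open>c i (e i) = 1\<close>
  is expanded along a finite combination \<open>g\<close> of basis vectors close to
  \<open>e i\<close>, and \<open>weak_type_coefficients\<close> supplies the weak-type bound for the
  \<open>x' n g\<close>.\<close>

lemma exists_large_functional:
  "\<exists>d>0. \<forall>i\<in>I. \<exists>n. d \<le> norm (c i (x n)) \<and> d \<le> norm (x' n (e i))"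
proof -
  obtain M where M_pos: "0 < M" and M: "\<forall>f\<in>carrier X. \<forall>A t. finite A \<longrightarrow> 0 < t \<longrightarrow>
      (\<forall>n\<in>A. t \<le> norm (x' n f)) \<longrightarrow> t powr p * card A \<le> M * qnorm X f powr p"
    using weak_type_coefficients by blast
  define U where "U = max (2 * \<kappa> * K) (L1 * K)"
  show ?thesis
  proof (rule exists_jointly_large[OF p_pos p_less_1, where U = U and M = "M * (2 * \<kappa>) powr p"])
    fix d :: real
    assume d: "0 < d" "\<And>(S :: nat set) a b. finite S \<Longrightarrow>
      (\<And>n. n \<in> S \<Longrightarrow> 0 \<le> a n \<and> a n \<le> U \<and> 0 \<le> b n \<and> b n \<le> U) \<Longrightarrow>
      (\<And>t. 0 < t \<Longrightarrow> t powr p * card {n\<in>S. t \<le> a n} \<le> M * (2 * \<kappa>) powr p) \<Longrightarrow>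
      1 / 2 \<le> (\<Sum>n\<in>S. a n * b n) \<Longrightarrow> \<exists>n\<in>S. d \<le> a n \<and> d \<le> b n"
    have "\<exists>n. d / 2 \<le> norm (c i (x n)) \<and> d / 2 \<le> norm (x' n (e i))" if i: "i \<in> I" for i
    proof -
      \<comment> \<open>Three tolerances: \<open>1\<close> keeps \<open>qnorm X g\<close> at most
        \<open>2 * \<kappa>\<close>, \<open>1 / (2 * L1)\<close> keeps \<open>c i g\<close> at least
        \<open>1 / 2\<close> in modulus, and \<open>d / (2 * K)\<close> allows the return from
        \<open>x' n g\<close> to \<open>x' n (e i)\<close> at the cost of
        \<open>d / 2\<close>.\<close>
      define r where "r = min 1 (min (1 / (2 * L1)) (d / (2 * K)))"
      have "r \<le> 1 / (2 * L1)" "r \<le> d / (2 * K)"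
        by (simp_all add: r_def)
      then have "L1 * r \<le> L1 * (1 / (2 * L1))" "K * r \<le> K * (d / (2 * K))"
        using L1_pos K by (intro mult_left_mono; simp)+
      moreover have "0 < r" "r \<le> 1"
        using d(1) L1_pos K by (simp_all add: r_def)
      ultimately have r: "0 < r" "r \<le> 1" "L1 * r \<le> 1 / 2" "K * r \<le> d / 2"
        using L1_pos K by simp_all
      obtain T u where T: "finite T" and eg: "qnorm X (e i - (\<Sum>n\<in>T. smult X (u n) (x n))) < r"
        using finite_combination_approx[OF e_carrier[OF i] r(1)] by blast
      define g where "g = (\<Sum>n\<in>T. smult X (u n) (x n))"
      have g: "g \<in> carrier X"
        unfolding g_def by (rule combination_carrier)
      have "qnorm X g \<le> \<kappa> * (qnorm X (e i) + qnorm X (e i - g))"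
        using qnorm_diff[OF e_carrier[OF i] diff_carrier[OF e_carrier[OF i] g]] by simp
      also have "\<dots> \<le> \<kappa> * (1 + 1)"
        using qnorm_e[OF i] eg r(2) \<kappa>_pos by (intro mult_left_mono) (auto simp: g_def)
      finally have g_le: "qnorm X g \<le> 2 * \<kappa>"
        by simp
      have x'_g: "x' n g = u n" if "n \<in> T" for n
        using that T by (simp add: g_def x'_combination)
      have "norm (c i (e i) - c i g) \<le> L1 * qnorm X (e i - g)"
        using norm_c[OF i diff_carrier[OF e_carrier[OF i] g]]
        by (simp add: linear_functional_diff[OF linear_c[OF i] e_carrier[OF i] g])
      also have "\<dots> \<le> L1 * r"
        using eg L1_pos by (intro mult_left_mono) (auto simp: g_def)
      finally have "1 / 2 \<le> norm (c i g)"
        using norm_triangle_ineq2[of 1 "c i g"] r(3) by (simp add: c_e i)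
      also have "c i g = (\<Sum>n\<in>T. x' n g * c i (x n))"
        unfolding g_def c_combination[OF i] using T by (intro sum.cong) (auto simp: x'_combination)
      also have "norm \<dots> \<le> (\<Sum>n\<in>T. norm (x' n g) * norm (c i (x n)))"
        by (intro order_trans[OF norm_sum]) (simp add: norm_mult)
      finally have "1 / 2 \<le> (\<Sum>n\<in>T. norm (x' n g) * norm (c i (x n)))" .
      moreover have "norm (x' n g) \<le> U" for n
      proof -
        have "norm (x' n g) \<le> K * qnorm X g"
          by (rule norm_x'[OF g])
        also have "\<dots> \<le> K * (2 * \<kappa>)"
          using g_le K by (intro mult_left_mono) auto
        finally show ?thesis
          by (simp add: U_def mult.commute)
      qed
      moreover have "norm (c i (x n)) \<le> U" for n
      proof -
        have "norm (c i (x n)) \<le> L1 * qnorm X (x n)"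
          by (intro norm_c i x_carrier)
        also have "\<dots> \<le> L1 * K"
          using L1_pos qnorm_x by (intro mult_left_mono) auto
        finally show ?thesis
          by (simp add: U_def)
      qed
      moreover have "t powr p * card {n\<in>T. t \<le> norm (x' n g)} \<le> M * (2 * \<kappa>) powr p" if "0 < t" for t
      proof -
        have "t powr p * card {n\<in>T. t \<le> norm (x' n g)} \<le> M * qnorm X g powr p"
          using g T that by (intro M[rule_format]) auto
        also have "\<dots> \<le> M * (2 * \<kappa>) powr p"
          using g_le qnorm_nonneg[OF g] M_pos p_pos by (intro mult_left_mono powr_mono2) auto
        finally show ?thesis .
      qed
      ultimately obtain n where n: "d \<le> norm (x' n g)" "d \<le> norm (c i (x n))"
        using d(2)[OF T, of "\<lambda>n. norm (x' n g)" "\<lambda>n. norm (c i (x n))"] by auto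
      have "norm (x' n (e i) - x' n g) \<le> K * qnorm X (e i - g)"
        using norm_x'[OF diff_carrier[OF e_carrier[OF i] g], of n] by (simp add: x'_diff e_carrier i g)
      also have "\<dots> \<le> K * r"
        using eg K by (intro mult_left_mono) (auto simp: g_def)
      finally have "d / 2 \<le> norm (x' n (e i))"
        using n(1) r(4) norm_triangle_ineq3[of "x' n (e i)" "x' n g"] by linarith
      with n(2) d(1) show ?thesis
        by (intro exI[of _ n]) auto
    qed
    then show ?thesis
      using d(1) by (intro exI[of _ "d / 2"]) auto
  qed
qed

text \<open>Strong democracy bounds a sum of basis vectors matched with a \<open>q\<close>-block, of
  order at least \<open>m powr (1 / q)\<close>, by a subsum of units of a \<open>p\<close>-block, of
  order at most \<open>m powr (1 / p)\<close>. For \<open>q < p\<close> this fails when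
  \<open>m\<close> is large.\<close>

lemma not_blocks:
  assumes q: "0 < q" "q < p"
    and p_block: "\<And>m. \<exists>J\<subseteq>I. card J = m \<and> lr_block X c e p J"
    and q_block: "\<And>m. \<exists>J\<subseteq>I. card J = m \<and> lr_block X c e q J"
  shows False
proof -
  obtain d where d: "0 < d" "\<And>i. i \<in> I \<Longrightarrow> \<exists>n. d \<le> norm (c i (x n)) \<and> d \<le> norm (x' n (e i))"
    using exists_large_functional by blast
  then obtain \<nu> where \<nu>: "\<And>i. i \<in> I \<Longrightarrow> d \<le> norm (c i (x (\<nu> i)))"
      "\<And>i. i \<in> I \<Longrightarrow> d \<le> norm (x' (\<nu> i) (e i))"
    by metis
  obtain N :: nat where "max 1 (L * K powr p / d powr p) < N"
    using reals_Archimedean2 by blast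
  then have N: "0 < N" "L * K powr p / d powr p \<le> N"
    by auto
  \<comment> \<open>Each \<open>i\<close> in the fibre over \<open>n\<close> gives a coordinate of
    \<open>x n\<close> of modulus at least \<open>d\<close>, and \<open>sum_c_le\<close> limits the
    number of these.\<close>
  have fibres: "real (card {i\<in>J. \<nu> i = n}) \<le> N" if J: "finite J" "J \<subseteq> I" for J n
  proof -
    have "d powr p * card {i\<in>J. \<nu> i = n} \<le> d powr p * card {i\<in>J. d \<le> norm (c i (x n))}"
      using \<nu>(1) J by (intro mult_left_mono of_nat_mono card_mono) auto
    also have "\<dots> \<le> L * qnorm X (x n) powr p"
      using J d(1) p_pos by (intro weak_type_of_sum sum_c_le x_carrier) auto
    also have "\<dots> \<le> L * K powr p"
      using qnorm_x qnorm_nonneg[OF x_carrier] L_pos p_pos by (intro mult_left_mono powr_mono2) auto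
    finally have "real (card {i\<in>J. \<nu> i = n}) \<le> L * K powr p / d powr p"
      using d(1) by (simp add: field_simps)
    then show ?thesis
      using N(2) by linarith
  qed
  have bound: "(d / 2)\<^sup>2 * (m / 2) powr (1 / q) \<le> greedy_const * (2 * N * m) powr (1 / p)" for m :: nat
  proof -
    \<comment> \<open>The size \<open>2 * N * m\<close> pays for fibres of at most \<open>N\<close>
      elements and for the half lost on passing to a subsum; at least \<open>m\<close> large
      coefficients remain.\<close>
    obtain J where J: "J \<subseteq> I" "card J = 2 * N * m" "lr_block X c e p J"
      using p_block by blast
    have fin_J: "finite J"
      using J(3) by (simp add: lr_block_def)
    have "real (card J) \<le> real N * real (card (\<nu> ` J))"
      using fibres fin_J J(1) by (intro card_le_fibres)
    then have "N * (2 * m) \<le> N * card (\<nu> ` J)"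
      unfolding J(2) by (simp only: of_nat_mult[symmetric] of_nat_le_iff mult_ac)
    then have 1: "2 * m \<le> card (\<nu> ` J)"
      using N(1) by simp
    have "\<exists>S\<subseteq>J. card (\<nu> ` J) \<le> 2 * card {n\<in>\<nu> ` J. d / 2 \<le> norm (\<Sum>i\<in>S. x' n (e i))}"
      using fin_J J(1) \<nu>(2) by (intro exists_subset_half_large) auto
    then obtain S where S: "S \<subseteq> J" "card (\<nu> ` J) \<le> 2 * card {n\<in>\<nu> ` J. d / 2 \<le> norm (\<Sum>i\<in>S. x' n (e i))}"
      by blast
    define D where "D = {n\<in>\<nu> ` J. d / 2 \<le> norm (\<Sum>i\<in>S. x' n (e i))}"
    have D: "finite D" "m \<le> card D"
      using S(2) 1 fin_J by (auto simp: D_def)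
    define f where "f = (\<Sum>i\<in>S. e i)"
    have f: "f \<in> carrier X"
      unfolding f_def using S(1) J(1) by (intro sum_carrier e_carrier) auto
    have x'_f: "x' n f = (\<Sum>i\<in>S. x' n (e i))" for n
      unfolding f_def using S(1) J(1) by (intro linear_functional_sum[OF linear_x'] e_carrier) auto
    have f_le: "qnorm X f \<le> (2 * N * m) powr (1 / p)"
      using J(3) S(1) unfolding lr_block_def J(2) f_def by simp

    obtain J' where J': "J' \<subseteq> I" "card J' = m" "lr_block X c e q J'"
      using q_block by blast
    have fin_J': "finite J'"
      using J'(3) by (simp add: lr_block_def)
    \<comment> \<open>The same selection with exchanged roles: subsums of basis vectors are tested
      on the coordinates of the \<open>q\<close>-block. Collisions of \<open>\<nu>\<close> do no
      harm here, as they only make \<open>B\<close> smaller.\<close>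
    have "\<exists>B\<subseteq>\<nu> ` J'. card J' \<le> 2 * card {j\<in>J'. d / 2 \<le> norm (\<Sum>n\<in>B. c j (x n))}"
      using fin_J' J'(1) \<nu>(1) by (intro exists_subset_half_large) auto
    then obtain B where B: "B \<subseteq> \<nu> ` J'" "card J' \<le> 2 * card {j\<in>J'. d / 2 \<le> norm (\<Sum>n\<in>B. c j (x n))}"
      by blast
    have "finite B" "card B \<le> m"
      using B(1) fin_J' J'(2) card_image_le[OF fin_J', of \<nu>] card_mono[of "\<nu> ` J'" B]
      by (auto intro: finite_subset)
    define s where "s = (\<Sum>n\<in>B. smult X 1 (x n))"
    have s: "s \<in> carrier X"
      unfolding s_def by (rule combination_carrier)
    define H where "H = {j\<in>J'. d / 2 \<le> norm (c j s)}"
    have "{j\<in>J'. d / 2 \<le> norm (\<Sum>n\<in>B. c j (x n))} = H"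
      using J'(1) unfolding H_def s_def by (intro Collect_cong) (auto simp: c_combination simp del: vec.scale_one)
    with B(2) have "m / 2 \<le> card H"
      unfolding J'(2) by simp
    then have "(d / 2) powr q * (m / 2) \<le> (d / 2) powr q * card H"
      by (intro mult_left_mono) auto
    also have "\<dots> \<le> qnorm X s powr q"
      unfolding H_def using fin_J' d(1) q s J'(3) by (intro weak_type_of_sum) (auto simp: lr_block_def)
    finally have "((d / 2) powr q * (m / 2)) powr (1 / q) \<le> (qnorm X s powr q) powr (1 / q)"
      using q by (intro powr_mono2) auto
    moreover have "((d / 2) powr q * (m / 2)) powr (1 / q) = d / 2 * (m / 2) powr (1 / q)"
      using q(1) d(1) by (subst powr_mult) (auto simp: powr_powr)
    moreover have "(qnorm X s powr q) powr (1 / q) = qnorm X s"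
      using q(1) qnorm_nonneg[OF s] by (simp add: powr_powr)
    ultimately have "d / 2 * (m / 2) powr (1 / q) \<le> qnorm X s"
      by simp
    then have "d / 2 * (d / 2 * (m / 2) powr (1 / q)) \<le> d / 2 * qnorm X s"
      using d(1) by (intro mult_left_mono) auto
    \<comment> \<open>Strong democracy at level \<open>d / 2\<close>: \<open>f\<close> has at least
      \<open>m\<close> such coefficients, on \<open>D\<close>, and \<open>B\<close> has at most
      \<open>m\<close> elements.\<close>
    also have "\<dots> \<le> greedy_const * qnorm X f"
      unfolding s_def using f D \<open>finite B\<close> \<open>card B \<le> m\<close> d(1)
      by (intro qnorm_combination_le[where A = D]) (auto simp: D_def x'_f)
    also have "\<dots> \<le> greedy_const * (2 * N * m) powr (1 / p)"
      using f_le greedy_const_pos by (intro mult_left_mono) auto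
    finally show ?thesis
      by (simp add: power2_eq_square)
  qed
  \<comment> \<open>Dividing \<open>bound\<close> by \<open>m powr (1 / p)\<close> leaves a positive
    power of \<open>m\<close> that would be bounded by the constant \<open>C\<close>.\<close>
  define s where "s = 1 / q - 1 / p"
  have s: "0 < s"
    using q by (simp add: s_def field_simps)
  define C where "C = greedy_const * (2 * N) powr (1 / p) * 2 powr (1 / q) / (d / 2)\<^sup>2"
  have upper: "real m powr s \<le> C" if "0 < m" for m
  proof -
    have "(d / 2)\<^sup>2 * real m powr (1 / q) \<le>
        greedy_const * (2 * N) powr (1 / p) * 2 powr (1 / q) * real m powr (1 / p)"
      using bound[of m] that by (simp add: powr_mult powr_divide field_simps)
    then show ?thesis
      using d(1) that by (simp add: C_def s_def powr_diff field_simps)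
  qed
  obtain m :: nat where m: "max 1 ((C + 1) powr (1 / s)) < m"
    using reals_Archimedean2 by blast
  have "0 \<le> C"
    using greedy_const_pos by (simp add: C_def)
  then have "C + 1 = ((C + 1) powr (1 / s)) powr s"
    using s by (simp add: powr_powr)
  also have "\<dots> \<le> real m powr s"
    using m s by (intro powr_mono2) auto
  finally show False
    using upper[of m] m by simp
qed

end

theorem (in coordinate_space) no_almost_greedy_basis:
  assumes "p < 1" "0 < q" "q < p"
    and "\<And>m. \<exists>J\<subseteq>I. card J = m \<and> lr_block X c e p J"
    and "\<And>m. \<exists>J\<subseteq>I. card J = m \<and> lr_block X c e q J"
  shows "\<not> has_almost_greedy_basis X"
proof
  assume "has_almost_greedy_basis X"
  then obtain x x' K where "almost_greedy_space X \<kappa> x x' K"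
    by (rule almost_greedy_spaceE)
  then interpret almost_greedy_space X \<kappa> x x' K .
  interpret coordinate_almost_greedy_space X \<kappa> I c e p L x x' K
    by unfold_locales (rule assms(1))
  show False
    using assms by (intro not_blocks)
qed

subsection \<open>Coordinates in sums of spaces\<close>

lemma sum_fun_apply: "(\<Sum>i\<in>A. f i) n = (\<Sum>i\<in>A. f i n)"
  for f :: "'a \<Rightarrow> 'b \<Rightarrow> 'c::comm_monoid_add"
  by (induction A rule: infinite_finite_induct) auto

text \<open>Serves for the exponents \<open>r\<close> and \<open>1 / r\<close> alike, hence on both
  sides of \<open>1\<close>.\<close>

lemma powr_add_le:
  fixes a b r :: real
  assumes "0 \<le> a" "0 \<le> b" "0 \<le> r"
  shows "(a + b) powr r \<le> 2 powr r * (a powr r + b powr r)"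
proof -
  have "(a + b) powr r \<le> (2 * max a b) powr r"
    using assms by (intro powr_mono2) auto
  also have "\<dots> = 2 powr r * max a b powr r"
    using assms by (simp add: powr_mult)
  also have "max a b powr r \<le> a powr r + b powr r"
    by (simp add: max_def)
  finally show ?thesis
    by simp
qed

text \<open>In \<open>a n powr s = a n * a n powr (s - 1)\<close> the second factor is at most that
  of the total. With \<open>s = p / r\<close> this is the inclusion of \<open>\<ell>\<^sub>r\<close>
  in \<open>\<ell>\<^sub>p\<close>.\<close>

lemma sum_powr_le_powr_sum:
  fixes a :: "'a \<Rightarrow> real"
  assumes "finite A" "\<And>n. n \<in> A \<Longrightarrow> 0 \<le> a n" "1 \<le> s"
  shows "(\<Sum>n\<in>A. a n powr s) \<le> (\<Sum>n\<in>A. a n) powr s"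
proof -
  have eq: "y * y powr (s - 1) = y powr s" if "0 \<le> y" for y :: real
    using that by (cases "y = 0") (auto simp: powr_diff)
  have nonneg: "0 \<le> (\<Sum>n\<in>A. a n)"
    using assms by (intro sum_nonneg)
  have "(\<Sum>n\<in>A. a n powr s) = (\<Sum>n\<in>A. a n * a n powr (s - 1))"
    using assms(2) by (intro sum.cong) (auto simp: eq)
  also have "\<dots> \<le> (\<Sum>n\<in>A. a n * (\<Sum>n\<in>A. a n) powr (s - 1))"
    using assms by (intro sum_mono mult_left_mono powr_mono2 member_le_sum) auto
  also have "\<dots> = (\<Sum>n\<in>A. a n) powr s"
    using eq[OF nonneg] by (simp add: sum_distrib_right[symmetric])
  finally show ?thesis .
qed

section \<open>Countable sums of spaces\<close>

lemma carrier_lsum: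
  "carrier (lsum r X) = {f. (\<forall>n. f n \<in> carrier (X n)) \<and> summable (\<lambda>n. qnorm (X n) (f n) powr r)}"
  and smult_lsum: "smult (lsum r X) = (\<lambda>a f n. smult (X n) a (f n))"
  and qnorm_lsum: "qnorm (lsum r X) f = (\<Sum>n. qnorm (X n) (f n) powr r) powr (1 / r)"
  by (simp_all add: lsum_def)

lemma qnorm_lsum_powr:
  assumes "0 < r" "f \<in> carrier (lsum r X)"
  shows "qnorm (lsum r X) f powr r = (\<Sum>n. qnorm (X n) (f n) powr r)"
  using assms suminf_nonneg[of "\<lambda>n. qnorm (X n) (f n) powr r"]
  by (simp add: qnorm_lsum powr_powr carrier_lsum)

text \<open>In the new constant, \<open>2 * \<kappa>\<close> comes from the inequality in each
  component and \<open>2 powr (1 / r)\<close> from the outer root.\<close>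

lemma quasi_normed_space_lsum:
  fixes X :: "nat \<Rightarrow> ('k::real_normed_field, 'v::ab_group_add) qspace"
  assumes r: "0 < r" and X: "\<And>n. quasi_normed_space (X n) \<kappa>"
  shows "quasi_normed_space (lsum r X) (2 * \<kappa> * 2 powr (1 / r))"
proof -
  interpret X: quasi_normed_space "X k" \<kappa> for k
    by (rule X)
  have scale: "qnorm (X n) (smult (X n) a (f n)) powr r = norm a powr r * qnorm (X n) (f n) powr r"
    if "f \<in> carrier (lsum r X)" for f a n
    using that X.qnorm_nonneg[of "f n" n] by (simp add: carrier_lsum X.qnorm_smult powr_mult)
  have add: "qnorm (X n) (f n + g n) powr r \<le>
      (2 * \<kappa>) powr r * (qnorm (X n) (f n) powr r + qnorm (X n) (g n) powr r)"
    if "f \<in> carrier (lsum r X)" "g \<in> carrier (lsum r X)" for f g n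
  proof -
    have fg: "f n \<in> carrier (X n)" "g n \<in> carrier (X n)"
      using that by (auto simp: carrier_lsum)
    have "qnorm (X n) (f n + g n) powr r \<le> (\<kappa> * (qnorm (X n) (f n) + qnorm (X n) (g n))) powr r"
      using r fg by (intro powr_mono2 X.qnorm_add X.qnorm_nonneg X.add_carrier) auto
    also have "\<dots> = \<kappa> powr r * (qnorm (X n) (f n) + qnorm (X n) (g n)) powr r"
      using fg X.\<kappa>_pos by (simp add: powr_mult X.qnorm_nonneg)
    also have "\<dots> \<le> \<kappa> powr r * (2 powr r * (qnorm (X n) (f n) powr r + qnorm (X n) (g n) powr r))"
      using fg r by (intro mult_left_mono powr_add_le X.qnorm_nonneg) auto
    finally show ?thesis
      using X.\<kappa>_pos by (simp add: powr_mult mult_ac)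
  qed
  have add_carrier: "f + g \<in> carrier (lsum r X)"
    if fg: "f \<in> carrier (lsum r X)" "g \<in> carrier (lsum r X)" for f g
  proof -
    have "summable (\<lambda>n. qnorm (X n) (f n + g n) powr r)"
    proof (rule summable_comparison_test')
      show "summable (\<lambda>n. (2 * \<kappa>) powr r * (qnorm (X n) (f n) powr r + qnorm (X n) (g n) powr r))"
        using fg by (intro summable_mult summable_add) (auto simp: carrier_lsum)
    qed (use add[OF fg] in simp)
    then show ?thesis
      using fg by (auto simp: carrier_lsum X.add_carrier)
  qed
  show ?thesis
  proof (rule quasi_normed_space.intro)
    fix f a assume f: "f \<in> carrier (lsum r X)"
    have sum: "summable (\<lambda>n. qnorm (X n) (f n) powr r)"
      using f by (simp add: carrier_lsum)
    have "qnorm (lsum r X) (smult (lsum r X) a f) =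
        (norm a powr r * (\<Sum>n. qnorm (X n) (f n) powr r)) powr (1 / r)"
      by (simp add: qnorm_lsum smult_lsum scale[OF f] suminf_mult[OF sum])
    then show "qnorm (lsum r X) (smult (lsum r X) a f) = norm a * qnorm (lsum r X) f"
      using r suminf_nonneg[OF sum] by (simp add: powr_mult powr_powr qnorm_lsum)
    show "smult (lsum r X) a f \<in> carrier (lsum r X)"
      using f scale[OF f] by (auto simp: carrier_lsum smult_lsum X.smult_carrier intro: summable_mult)
  next
    fix f g assume fg: "f \<in> carrier (lsum r X)" "g \<in> carrier (lsum r X)"
    then have sum: "summable (\<lambda>n. qnorm (X n) (f n) powr r)" "summable (\<lambda>n. qnorm (X n) (g n) powr r)"
      by (auto simp: carrier_lsum)
    define F G where "F = (\<Sum>n. qnorm (X n) (f n) powr r)" and "G = (\<Sum>n. qnorm (X n) (g n) powr r)"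
    have FG: "0 \<le> F" "0 \<le> G"
      unfolding F_def G_def using sum by (auto intro: suminf_nonneg)
    have "(\<Sum>n. qnorm (X n) ((f + g) n) powr r) \<le>
        (\<Sum>n. (2 * \<kappa>) powr r * (qnorm (X n) (f n) powr r + qnorm (X n) (g n) powr r))"
      using add[OF fg] add_carrier[OF fg] sum
      by (intro suminf_le summable_mult summable_add) (auto simp: carrier_lsum)
    also have "\<dots> = (2 * \<kappa>) powr r * (F + G)"
      unfolding F_def G_def using sum by (simp add: suminf_mult suminf_add summable_add)
    finally have "qnorm (lsum r X) (f + g) \<le> ((2 * \<kappa>) powr r * (F + G)) powr (1 / r)"
      unfolding qnorm_lsum using r add_carrier[OF fg]
      by (intro powr_mono2 suminf_nonneg) (auto simp: carrier_lsum)
    also have "\<dots> = 2 * \<kappa> * (F + G) powr (1 / r)"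
      using r FG X.\<kappa>_pos by (simp add: powr_mult powr_powr)
    also have "\<dots> \<le> 2 * \<kappa> * (2 powr (1 / r) * (F powr (1 / r) + G powr (1 / r)))"
      using r FG X.\<kappa>_pos by (intro mult_left_mono powr_add_le) auto
    finally show "qnorm (lsum r X) (f + g) \<le>
        2 * \<kappa> * 2 powr (1 / r) * (qnorm (lsum r X) f + qnorm (lsum r X) g)"
      by (simp add: qnorm_lsum F_def G_def)
  next
    show "module (smult (lsum r X))"
      by (rule module.intro)
        (auto simp: smult_lsum fun_eq_iff X.vec.scale_right_distrib X.vec.scale_left_distrib)
    show "0 \<in> carrier (lsum r X)"
      by (simp add: carrier_lsum X.zero_carrier X.qnorm_zero)
    show "0 \<le> qnorm (lsum r X) f" if "f \<in> carrier (lsum r X)" for f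
      by (simp add: qnorm_lsum)
    show "0 < 2 * \<kappa> * 2 powr (1 / r)"
      using X.\<kappa>_pos by simp
  qed (rule add_carrier)
qed

definition single :: "nat \<Rightarrow> 'v::zero \<Rightarrow> nat \<Rightarrow> 'v" where
  "single n v = (\<lambda>k. if k = n then v else 0)"

lemma single_apply: "single n v k = (if k = n then v else 0)"
  by (simp add: single_def)

lemma
  fixes X :: "nat \<Rightarrow> ('k::real_normed_field, 'v::ab_group_add) qspace"
  assumes r: "0 < r" and X: "\<And>n. quasi_normed_space (X n) \<kappa>" and v: "v \<in> carrier (X n)"
  shows single_carrier: "single n v \<in> carrier (lsum r X)"
    and qnorm_single: "qnorm (lsum r X) (single n v) = qnorm (X n) v"
proof -
  interpret X: quasi_normed_space "X k" \<kappa> for k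
    by (rule X)
  have "(\<lambda>k. qnorm (X k) (single n v k) powr r) = (\<lambda>k. if k = n then qnorm (X k) v powr r else 0)"
    by (auto simp: single_apply X.qnorm_zero)
  then have sums: "(\<lambda>k. qnorm (X k) (single n v k) powr r) sums (qnorm (X n) v powr r)"
    using sums_single[of n "\<lambda>k. qnorm (X k) v powr r"] by simp
  then show "single n v \<in> carrier (lsum r X)"
    using v by (auto simp: carrier_lsum single_apply X.zero_carrier intro: sums_summable)
  show "qnorm (lsum r X) (single n v) = qnorm (X n) v"
    using r v sums_unique[OF sums] by (simp add: qnorm_lsum powr_powr X.qnorm_nonneg flip: sums_unique[OF sums])
qed

lemma qnorm_component_le:
  fixes X :: "nat \<Rightarrow> ('k::real_normed_field, 'v::ab_group_add) qspace"
  assumes r: "0 < r" and X: "\<And>n. quasi_normed_space (X n) \<kappa>" and f: "f \<in> carrier (lsum r X)"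
  shows "qnorm (X n) (f n) \<le> qnorm (lsum r X) f"
proof -
  interpret X: quasi_normed_space "X k" \<kappa> for k
    by (rule X)
  have "qnorm (X n) (f n) = (\<Sum>k\<in>{n}. qnorm (X k) (f k) powr r) powr (1 / r)"
    using r f by (simp add: powr_powr X.qnorm_nonneg carrier_lsum)
  also have "\<dots> \<le> (\<Sum>k. qnorm (X k) (f k) powr r) powr (1 / r)"
    using r f by (intro powr_mono2 sum_le_suminf) (auto simp: carrier_lsum)
  finally show ?thesis
    by (simp add: qnorm_lsum)
qed

abbreviation "lsum_coord c \<equiv> (\<lambda>(n, j) f. c j (f n))"
abbreviation "lsum_unit e \<equiv> (\<lambda>(n, j). single n (e j))"

text \<open>All components share \<open>c\<close> and \<open>e\<close> and differ only in the index
  set \<open>I n\<close>, which fits the spaces \<open>lp_fin\<close>. The bound with exponent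
  \<open>p\<close> passes to the sum because \<open>r \<le> p\<close>; density follows by cutting
  off the tail and approximating finitely many components.\<close>

lemma coordinate_space_lsum:
  fixes X :: "nat \<Rightarrow> ('k::real_normed_field, 'v::ab_group_add) qspace"
  assumes r: "0 < r" "r \<le> p" and X: "\<And>n. coordinate_space (X n) \<kappa> (I n) c e p L"
  shows "coordinate_space (lsum r X) (2 * \<kappa> * 2 powr (1 / r)) (Sigma UNIV I)
    (lsum_coord c) (lsum_unit e) p L"
proof -
  interpret X: coordinate_space "X n" \<kappa> "I n" c e p L for n
    by (rule X)
  note qn = X.quasi_normed_space_axioms
  interpret S: quasi_normed_space "lsum r X" "2 * \<kappa> * 2 powr (1 / r)"
    by (rule quasi_normed_space_lsum[OF r(1) qn])
  have c_zero: "c j 0 = 0" if "j \<in> I n" for j n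
    using X.linear_functional_zero[OF X.linear_c[OF that]] .
  show ?thesis
  proof
    show "0 < p" "0 < L"
      by (rule X.p_pos X.L_pos)+
  next
    fix i assume "i \<in> Sigma UNIV I"
    then obtain n j where i: "i = (n, j)" "j \<in> I n"
      by auto
    show "linear_functional (lsum r X) (lsum_coord c i)"
      using X.linear_c[OF i(2)] by (auto simp: i linear_functional_def carrier_lsum smult_lsum)
    show "lsum_unit e i \<in> carrier (lsum r X)"
      unfolding i prod.case using X.e_carrier[OF i(2)] by (rule single_carrier[OF r(1) qn])
    show "qnorm (lsum r X) (lsum_unit e i) \<le> 1"
      using X.qnorm_e[OF i(2)] qnorm_single[of r X \<kappa> "e j" n, OF r(1) qn X.e_carrier[OF i(2)]]
      by (simp add: i)
  next
    fix i k assume "i \<in> Sigma UNIV I" "k \<in> Sigma UNIV I"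
    then obtain n j m l where "i = (n, j)" "j \<in> I n" "k = (m, l)" "l \<in> I m"
      by auto
    then show "lsum_coord c i (lsum_unit e k) = (if i = k then 1 else 0)"
      by (cases "n = m") (auto simp: single_apply X.c_e c_zero)
  next
    fix F f assume F: "finite F" "F \<subseteq> Sigma UNIV I" and f: "f \<in> carrier (lsum r X)"
    have fn: "f n \<in> carrier (X n)" for n
      using f by (simp add: carrier_lsum)
    define R where "R n = {j. (n, j) \<in> F}" for n
    have R: "finite (R n)" "R n \<subseteq> I n" for n
      using F finite_vimageI[OF F(1), of "Pair n"] by (auto simp: R_def vimage_def inj_on_def)
    have F_eq: "F = Sigma (fst ` F) R"
      by (force simp: R_def)
    have "(\<Sum>i\<in>F. norm (lsum_coord c i f) powr p) = (\<Sum>n\<in>fst ` F. \<Sum>j\<in>R n. norm (c j (f n)) powr p)"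
      using F(1) R by (subst F_eq, subst sum.Sigma) (auto intro: sum.cong)
    also have "\<dots> \<le> (\<Sum>n\<in>fst ` F. L * qnorm (X n) (f n) powr p)"
      using R by (intro sum_mono X.sum_c_le fn)
    \<comment> \<open>The exponent is split as \<open>p = r * (p / r)\<close> with
      \<open>p / r \<ge> 1\<close>, ready for \<open>sum_powr_le_powr_sum\<close>.\<close>
    also have "\<dots> = L * (\<Sum>n\<in>fst ` F. (qnorm (X n) (f n) powr r) powr (p / r))"
      using r by (simp add: sum_distrib_left powr_powr)
    also have "\<dots> \<le> L * (\<Sum>n\<in>fst ` F. qnorm (X n) (f n) powr r) powr (p / r)"
      using r F(1) X.L_pos by (intro mult_left_mono sum_powr_le_powr_sum) auto
    also have "\<dots> \<le> L * (qnorm (lsum r X) f powr r) powr (p / r)"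
      unfolding qnorm_lsum_powr[OF r(1) f] using r f F(1) X.L_pos
      by (intro mult_left_mono powr_mono2 sum_nonneg sum_le_suminf) (auto simp: carrier_lsum)
    also have "\<dots> = L * qnorm (lsum r X) f powr p"
      using r by (simp add: powr_powr)
    finally show "(\<Sum>i\<in>F. norm (lsum_coord c i f) powr p) \<le> L * qnorm (lsum r X) f powr p" .
  next
    fix f and t :: real assume f: "f \<in> carrier (lsum r X)" and t: "0 < t"
    have fn: "f n \<in> carrier (X n)" for n
      using f by (simp add: carrier_lsum)
    have sum: "summable (\<lambda>n. qnorm (X n) (f n) powr r)"
      using f by (simp add: carrier_lsum)
    \<comment> \<open>Half of \<open>t powr r\<close> is reserved for the tail and half for the
      first \<open>N\<close> components.\<close>
    define \<eta> where "\<eta> = t powr r / 2"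
    have \<eta>: "0 < \<eta>"
      using t by (simp add: \<eta>_def)
    obtain N where N: "norm (\<Sum>n. qnorm (X (n + N)) (f (n + N)) powr r) < \<eta>"
      using suminf_exist_split[OF \<eta> sum] by blast
    \<comment> \<open>\<open>N + 1\<close> instead of \<open>N\<close> avoids a division by zero;
      the \<open>N\<close> errors still add up to at most \<open>\<eta>\<close>.\<close>
    define \<delta> where "\<delta> = (\<eta> / (N + 1)) powr (1 / r)"
    have \<delta>: "0 < \<delta>" "\<delta> powr r = \<eta> / (N + 1)"
      using \<eta> r by (simp_all add: \<delta>_def powr_powr)
    have "\<exists>R. finite R \<and> R \<subseteq> I n \<and> qnorm (X n) (f n - (\<Sum>j\<in>R. smult (X n) (c j (f n)) (e j))) < \<delta>" for n
      by (rule X.dense_e[OF fn \<delta>(1)])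
    then obtain R where R: "\<And>n. finite (R n)" "\<And>n. R n \<subseteq> I n"
      "\<And>n. qnorm (X n) (f n - (\<Sum>j\<in>R n. smult (X n) (c j (f n)) (e j))) < \<delta>"
      by metis
    define F where "F = Sigma {..<N} R"
    have F: "finite F" "F \<subseteq> Sigma UNIV I"
      using R by (auto simp: F_def)
    let ?y = "\<Sum>i\<in>F. smult (lsum r X) (lsum_coord c i f) (lsum_unit e i)"
    have y: "?y n = (if n < N then (\<Sum>j\<in>R n. smult (X n) (c j (f n)) (e j)) else 0)" for n
    proof -
      have "?y n = (\<Sum>k<N. \<Sum>j\<in>R k. smult (X n) (c j (f k)) (single k (e j) n))"
        unfolding F_def sum_fun_apply using R(1)
        by (subst sum.Sigma) (auto simp: smult_lsum intro!: sum.cong)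
      also have "\<dots> = (\<Sum>k<N. if k = n then (\<Sum>j\<in>R n. smult (X n) (c j (f n)) (e j)) else 0)"
        by (intro sum.cong) (auto simp: single_apply)
      finally show ?thesis
        by simp
    qed
    have "?y \<in> carrier (lsum r X)"
      using F X.e_carrier by (intro S.sum_carrier S.smult_carrier) (auto intro!: single_carrier[OF r(1) qn])
    then have h: "f - ?y \<in> carrier (lsum r X)"
      by (rule S.diff_carrier[OF f])
    then have h_sum: "summable (\<lambda>n. qnorm (X n) ((f - ?y) n) powr r)"
      by (simp add: carrier_lsum)
    have h_n: "(f - ?y) n \<in> carrier (X n)" for n
      using h by (simp add: carrier_lsum)
    have "qnorm (lsum r X) (f - ?y) powr r =
        (\<Sum>n. qnorm (X (n + N)) ((f - ?y) (n + N)) powr r) + (\<Sum>n<N. qnorm (X n) ((f - ?y) n) powr r)"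
      unfolding qnorm_lsum_powr[OF r(1) h] by (rule suminf_split_initial_segment[OF h_sum])
    also have "(\<Sum>n. qnorm (X (n + N)) ((f - ?y) (n + N)) powr r) < \<eta>"
      using N by (simp add: y)
    also have "(\<Sum>n<N. qnorm (X n) ((f - ?y) n) powr r) \<le> (\<Sum>n<N. \<delta> powr r)"
    proof (intro sum_mono powr_mono2)
      show "qnorm (X n) ((f - ?y) n) \<le> \<delta>" if "n \<in> {..<N}" for n
        using that R(3)[of n] by (simp add: y)
    qed (use r X.qnorm_nonneg[OF h_n] in auto)
    also have "\<dots> \<le> \<eta>"
      using \<eta> by (simp add: \<delta>(2) field_simps)
    finally have "qnorm (lsum r X) (f - ?y) powr r < t powr r"
      by (simp add: \<eta>_def)
    then have "qnorm (lsum r X) (f - ?y) < t"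
      using r t S.qnorm_nonneg[OF h] powr_mono2[of r t "qnorm (lsum r X) (f - ?y)"] by force
    then show "\<exists>F. finite F \<and> F \<subseteq> Sigma UNIV I \<and>
        qnorm (lsum r X) (f - (\<Sum>i\<in>F. smult (lsum r X) (lsum_coord c i f) (lsum_unit e i))) < t"
      using F by blast
  qed
qed

text \<open>Embedding a component preserves the quasi-norm and projecting onto it does not increase
  it, so a block inside one component keeps its exponent \<open>s\<close>.\<close>

lemma lr_block_row:
  fixes X :: "nat \<Rightarrow> ('k::real_normed_field, 'v::ab_group_add) qspace"
  assumes r: "0 < r" and s: "0 < s" and X: "\<And>n. quasi_normed_space (X n) \<kappa>"
    and J: "lr_block (X n) c e s J" "\<And>j. j \<in> J \<Longrightarrow> e j \<in> carrier (X n)"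
  shows "lr_block (lsum r X) (lsum_coord c) (lsum_unit e) s (Pair n ` J)"
  unfolding lr_block_def
proof (intro conjI allI ballI impI)
  interpret X: quasi_normed_space "X k" \<kappa> for k
    by (rule X)
  have card: "card (Pair n ` J) = card J"
    by (simp add: card_image inj_on_def)
  show "finite (Pair n ` J)"
    using J(1) by (simp add: lr_block_def)
  show "qnorm (lsum r X) (\<Sum>i\<in>S. lsum_unit e i) \<le> card (Pair n ` J) powr (1 / s)" if "S \<subseteq> Pair n ` J" for S
  proof -
    obtain T where T: "T \<subseteq> J" "S = Pair n ` T"
      using \<open>S \<subseteq> _\<close> by (rule subset_imageE)
    have "(\<Sum>i\<in>S. lsum_unit e i) = (\<Sum>j\<in>T. single n (e j))"
      unfolding T(2) by (simp add: sum.reindex inj_on_def)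
    also have "\<dots> = single n (\<Sum>j\<in>T. e j)"
      by (auto simp: single_apply sum_fun_apply)
    finally have "(\<Sum>i\<in>S. lsum_unit e i) = single n (\<Sum>j\<in>T. e j)" .
    moreover have "(\<Sum>j\<in>T. e j) \<in> carrier (X n)"
      using T(1) J(2) by (intro X.sum_carrier) auto
    ultimately have "qnorm (lsum r X) (\<Sum>i\<in>S. lsum_unit e i) = qnorm (X n) (\<Sum>j\<in>T. e j)"
      by (simp only: qnorm_single[OF r X])
    then show ?thesis
      using J(1) T(1) by (simp add: lr_block_def card)
  qed
  show "(\<Sum>i\<in>Pair n ` J. norm (lsum_coord c i f) powr s) \<le> qnorm (lsum r X) f powr s"
    if f: "f \<in> carrier (lsum r X)" for f
  proof -
    have fn: "f n \<in> carrier (X n)"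
      using f by (simp add: carrier_lsum)
    have "(\<Sum>i\<in>Pair n ` J. norm (lsum_coord c i f) powr s) = (\<Sum>j\<in>J. norm (c j (f n)) powr s)"
      by (simp add: sum.reindex inj_on_def)
    also have "\<dots> \<le> qnorm (X n) (f n) powr s"
      using J(1) fn by (simp add: lr_block_def)
    also have "\<dots> \<le> qnorm (lsum r X) f powr s"
      using s X.qnorm_nonneg[OF fn] by (intro powr_mono2 qnorm_component_le[OF r X f]) auto
    finally show ?thesis .
  qed
qed

text \<open>With one unit vector per component the outer exponent \<open>r\<close> governs. The
  singleton blocks encode \<open>qnorm (X n) (e j) \<le> 1\<close> and
  \<open>norm (c j f) \<le> qnorm (X n) f\<close>.\<close>

lemma lr_block_column:
  fixes X :: "nat \<Rightarrow> ('k::real_normed_field, 'v::ab_group_add) qspace"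
  assumes r: "0 < r" and s: "0 < s" and X: "\<And>n. quasi_normed_space (X n) \<kappa>"
    and j: "\<And>n. lr_block (X n) c e s {j}" "\<And>n. e j \<in> carrier (X n)" and N: "finite N"
  shows "lr_block (lsum r X) (lsum_coord c) (lsum_unit e) r ((\<lambda>n. (n, j)) ` N)"
  unfolding lr_block_def
proof (intro conjI allI ballI impI)
  interpret X: quasi_normed_space "X k" \<kappa> for k
    by (rule X)
  have card: "card ((\<lambda>n. (n, j)) ` N) = card N"
    by (simp add: card_image inj_on_def)
  have e_le: "qnorm (X n) (e j) \<le> 1" for n
    using j(1)[of n] unfolding lr_block_def by (auto dest: spec[of _ "{j}"])
  show "finite ((\<lambda>n. (n, j)) ` N)"
    using N by simp
  show "qnorm (lsum r X) (\<Sum>i\<in>S. lsum_unit e i) \<le> card ((\<lambda>n. (n, j)) ` N) powr (1 / r)"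
    if "S \<subseteq> (\<lambda>n. (n, j)) ` N" for S
  proof -
    obtain T where T: "T \<subseteq> N" "S = (\<lambda>n. (n, j)) ` T"
      using \<open>S \<subseteq> _\<close> by (rule subset_imageE)
    have T_fin: "finite T"
      using T(1) N by (rule finite_subset)
    have "(\<Sum>i\<in>S. lsum_unit e i) = (\<lambda>k. if k \<in> T then e j else 0)"
      unfolding T(2) using T_fin by (simp add: sum.reindex inj_on_def sum_fun_apply fun_eq_iff single_apply)
    then have "(\<Sum>k. qnorm (X k) ((\<Sum>i\<in>S. lsum_unit e i) k) powr r) = (\<Sum>k\<in>T. qnorm (X k) (e j) powr r)"
      using T_fin by (subst suminf_finite[of T]) (auto simp: X.qnorm_zero)
    also have "\<dots> \<le> (\<Sum>k\<in>T. 1 powr r)"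
      using j(2) r e_le by (intro sum_mono powr_mono2 X.qnorm_nonneg) auto
    also have "\<dots> \<le> card N"
      using T(1) N by (simp add: card_mono)
    finally have "(\<Sum>k. qnorm (X k) ((\<Sum>i\<in>S. lsum_unit e i) k) powr r) \<le> card N" .
    moreover have "0 \<le> (\<Sum>k. qnorm (X k) ((\<Sum>i\<in>S. lsum_unit e i) k) powr r)"
      unfolding \<open>_ = (\<Sum>k\<in>T. qnorm (X k) (e j) powr r)\<close> by (simp add: sum_nonneg)
    ultimately show ?thesis
      unfolding qnorm_lsum card using r by (intro powr_mono2) auto
  qed
  show "(\<Sum>i\<in>(\<lambda>n. (n, j)) ` N. norm (lsum_coord c i f) powr r) \<le> qnorm (lsum r X) f powr r"
    if f: "f \<in> carrier (lsum r X)" for f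
  proof -
    have fn: "f n \<in> carrier (X n)" for n
      using f by (simp add: carrier_lsum)
    have le: "norm (c j (f n)) \<le> qnorm (X n) (f n)" for n
    proof -
      have "norm (c j (f n)) powr s \<le> qnorm (X n) (f n) powr s"
        using j(1)[of n] fn by (simp add: lr_block_def)
      then show ?thesis
        using s X.qnorm_nonneg[OF fn] powr_less_mono2[of s "qnorm (X n) (f n)" "norm (c j (f n))"] by force
    qed
    have "(\<Sum>i\<in>(\<lambda>n. (n, j)) ` N. norm (lsum_coord c i f) powr r) = (\<Sum>n\<in>N. norm (c j (f n)) powr r)"
      by (simp add: sum.reindex inj_on_def)
    also have "\<dots> \<le> (\<Sum>n\<in>N. qnorm (X n) (f n) powr r)"
      using r le by (intro sum_mono powr_mono2) auto
    also have "\<dots> \<le> (\<Sum>n. qnorm (X n) (f n) powr r)"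
      using f N by (intro sum_le_suminf) (auto simp: carrier_lsum)
    also have "\<dots> = qnorm (lsum r X) f powr r"
      by (rule qnorm_lsum_powr[OF r f, symmetric])
    finally show ?thesis .
  qed
qed

section \<open>Subspaces given by vanishing coordinates\<close>

lemma coordinate_subspace:
  assumes "coordinate_space X \<kappa> I c e p L" and J: "J \<subseteq> I"
    and smult: "smult Y = smult X"
    and carrier: "carrier Y = {f \<in> carrier X. \<forall>i\<in>I - J. c i f = 0}"
    and qnorm: "\<And>f. f \<in> carrier Y \<Longrightarrow> qnorm Y f = qnorm X f"
  shows "coordinate_space Y \<kappa> J c e p L"
proof -
  interpret X: coordinate_space X \<kappa> I c e p L
    by (rule assms(1))
  have c_add: "c i (f + g) = c i f + c i g" if "i \<in> I" "f \<in> carrier X" "g \<in> carrier X" for i f g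
    using X.linear_c[OF that(1)] that unfolding linear_functional_def by blast
  have c_smult: "c i (smult X a f) = a * c i f" if "i \<in> I" "f \<in> carrier X" for i a f
    using X.linear_c[OF that(1)] that unfolding linear_functional_def by blast
  interpret Y: quasi_normed_space Y \<kappa>
  proof (rule quasi_normed_space.intro)
    show zero: "0 \<in> carrier Y"
      using X.linear_functional_zero[OF X.linear_c] by (auto simp: carrier X.zero_carrier)
    show add: "f + g \<in> carrier Y" if "f \<in> carrier Y" "g \<in> carrier Y" for f g
      using that c_add by (auto simp: carrier X.add_carrier)
    show sm: "smult Y a f \<in> carrier Y" if "f \<in> carrier Y" for a f
      using that c_smult by (auto simp: carrier smult X.smult_carrier)
    show "qnorm Y (smult Y a f) = norm a * qnorm Y f" if "f \<in> carrier Y" for a f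
      using sm[OF that, of a] that by (simp add: qnorm) (simp add: carrier smult X.qnorm_smult)
    show "qnorm Y (f + g) \<le> \<kappa> * (qnorm Y f + qnorm Y g)" if "f \<in> carrier Y" "g \<in> carrier Y" for f g
      using add[OF that] that by (simp add: qnorm) (simp add: carrier X.qnorm_add)
    show "0 \<le> qnorm Y f" if "f \<in> carrier Y" for f
      using that by (simp add: qnorm) (simp add: carrier X.qnorm_nonneg)
    show "module (smult Y)"
      unfolding smult by (rule X.module_smult)
  qed (rule X.\<kappa>_pos)
  have e: "e i \<in> carrier Y" if "i \<in> J" for i
    using that J X.e_carrier by (auto simp: carrier X.c_e)
  show ?thesis
  proof
    show "0 < p" "0 < L"
      by (rule X.p_pos X.L_pos)+
    show "linear_functional Y (c i)" if "i \<in> J" for i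
      using X.linear_c[of i] that J by (auto simp: linear_functional_def carrier smult)
    show "e i \<in> carrier Y" if "i \<in> J" for i
      by (rule e[OF that])
    show "qnorm Y (e i) \<le> 1" if "i \<in> J" for i
      using X.qnorm_e[of i] that J by (auto simp: qnorm[OF e])
    show "c i (e j) = (if i = j then 1 else 0)" if "i \<in> J" "j \<in> J" for i j
      using X.c_e[of i j] that J by (auto simp: subset_iff)
    show "(\<Sum>i\<in>F. norm (c i f) powr p) \<le> L * qnorm Y f powr p"
      if "finite F" "F \<subseteq> J" "f \<in> carrier Y" for F f
      using X.sum_c_le[of F f] that J by (simp add: qnorm) (simp add: carrier)
    show "\<exists>F. finite F \<and> F \<subseteq> J \<and> qnorm Y (f - (\<Sum>i\<in>F. smult Y (c i f) (e i))) < r"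
      if f: "f \<in> carrier Y" and "0 < r" for f and r :: real
    proof -
      have "f \<in> carrier X"
        using f by (simp add: carrier)
      then obtain F where F: "finite F" "F \<subseteq> I" "qnorm X (f - (\<Sum>i\<in>F. smult X (c i f) (e i))) < r"
        using X.dense_e \<open>0 < r\<close> by blast
      \<comment> \<open>The coordinates of \<open>f\<close> outside \<open>J\<close> vanish, so the
        approximating sum taken in \<open>X\<close> already lies in \<open>Y\<close>.\<close>
      have "(\<Sum>i\<in>F. smult X (c i f) (e i)) = (\<Sum>i\<in>F \<inter> J. smult X (c i f) (e i))"
      proof (rule sum.mono_neutral_right)
        show "\<forall>i\<in>F - F \<inter> J. smult X (c i f) (e i) = 0"
        proof
          fix i assume "i \<in> F - F \<inter> J"
          then have "c i f = 0"
            using F(2) f by (auto simp: carrier)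
          then show "smult X (c i f) (e i) = 0"
            by simp
        qed
      qed (use F in auto)
      moreover have "f - (\<Sum>i\<in>F \<inter> J. smult Y (c i f) (e i)) \<in> carrier Y"
        using f e by (intro Y.diff_carrier Y.sum_carrier Y.smult_carrier) auto
      ultimately show ?thesis
        using F by (intro exI[of _ "F \<inter> J"]) (simp add: qnorm, simp add: smult)
    qed
  qed
qed

lemma lr_block_subspace:
  assumes "lr_block X c e s J" "quasi_normed_space Y \<kappa>" "\<And>i. i \<in> J \<Longrightarrow> e i \<in> carrier Y"
    and "carrier Y \<subseteq> carrier X" "\<And>f. f \<in> carrier Y \<Longrightarrow> qnorm Y f = qnorm X f"
  shows "lr_block Y c e s J"
proof -
  interpret Y: quasi_normed_space Y \<kappa>
    by (rule assms(2))
  have "(\<Sum>i\<in>S. e i) \<in> carrier Y" if "S \<subseteq> J" for S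
    using that assms(3) by (intro Y.sum_carrier) auto
  then show ?thesis
    using assms(1,4,5) by (auto simp: lr_block_def subset_iff)
qed

section \<open>Scalars and sequence spaces\<close>

lemma coordinate_space_scalars:
  assumes "0 < p"
  shows "coordinate_space (scalars :: ('k::real_normed_field, 'k) qspace) 1 UNIV (\<lambda>_::unit. id) (\<lambda>_. 1) p 1"
proof -
  have "module ((*) :: 'k \<Rightarrow> 'k \<Rightarrow> 'k)"
    by unfold_locales (auto simp: algebra_simps)
  then interpret quasi_normed_space "scalars :: ('k, 'k) qspace" 1
    by (intro quasi_normed_space.intro) (auto simp: scalars_def norm_mult norm_triangle_ineq)
  show ?thesis
  proof
    show "(\<Sum>i\<in>F. norm (id f) powr p) \<le> 1 * qnorm scalars f powr p"
      if "finite F" for F :: "unit set" and f :: 'k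
    proof -
      have "F = {} \<or> F = {()}"
        by auto
      then show ?thesis
        by (auto simp: scalars_def)
    qed
    show "\<exists>F::unit set. finite F \<and> F \<subseteq> UNIV \<and> qnorm scalars (f - (\<Sum>i\<in>F. smult scalars (id f) 1)) < r"
      if "0 < r" for f :: 'k and r :: real
      using that by (intro exI[of _ "{()}"]) (simp add: scalars_def)
  qed (use assms in \<open>auto simp: scalars_def linear_functional_def\<close>)
qed

lemma lr_block_scalars: "lr_block (scalars :: ('k::real_normed_field, 'k) qspace) (\<lambda>_::unit. id) (\<lambda>_. 1) s {()}"
  by (auto simp: lr_block_def scalars_def subset_singleton_iff)

text \<open>\<open>lp\<close> is an \<open>lsum\<close> of one-dimensional spaces with the single
  index \<open>()\<close>, so its coordinates are indexed by the pairs
  \<open>(n, ())\<close>.\<close>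

abbreviation "seq_coord \<equiv> lsum_coord (\<lambda>_::unit. id)"
abbreviation "seq_unit \<equiv> lsum_unit (\<lambda>_::unit. 1)"

lemma coordinate_space_lp:
  assumes "0 < r" "r \<le> p"
  shows "coordinate_space (lp TYPE('k::real_normed_field) r) (2 * 1 * 2 powr (1 / r)) (Sigma UNIV (\<lambda>_. UNIV)) seq_coord seq_unit p 1"
  unfolding lp_def using assms by (intro coordinate_space_lsum coordinate_space_scalars) auto

lemma lr_block_lp:
  assumes r: "0 < r" and s: "0 < s"
  shows "lr_block (lp TYPE('k::real_normed_field) r) seq_coord seq_unit r ((\<lambda>n. (n, ())) ` {..<m})"
    and "lr_block (lp TYPE('k::real_normed_field) r) seq_coord seq_unit s {(n, ())}"
proof -
  interpret scalars: coordinate_space "scalars :: ('k, 'k) qspace" 1 UNIV "\<lambda>_::unit. id" "\<lambda>_. 1" 1 1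
    by (rule coordinate_space_scalars) simp
  note [intro] = scalars.quasi_normed_space_axioms
  \<comment> \<open>A column of one-dimensional blocks. The scalars form a block for every exponent,
    and \<open>s = 1\<close> is one choice.\<close>
  show "lr_block (lp TYPE('k::real_normed_field) r) seq_coord seq_unit r ((\<lambda>n. (n, ())) ` {..<m})"
    unfolding lp_def using r
    by (intro lr_block_column[where s = 1 and \<kappa> = 1] lr_block_scalars) (auto simp: scalars.e_carrier)
  have "lr_block (lp TYPE('k::real_normed_field) r) seq_coord seq_unit s (Pair n ` {()})"
    unfolding lp_def using r s
    by (intro lr_block_row[where \<kappa> = 1] lr_block_scalars) (auto simp: scalars.e_carrier)
  then show "lr_block (lp TYPE('k::real_normed_field) r) seq_coord seq_unit s {(n, ())}"
    by simp
qed

text \<open>Presents \<open>lp_fin\<close> as a subspace of \<open>lp\<close> to which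
  \<open>coordinate_subspace\<close> and \<open>lr_block_subspace\<close> apply.\<close>

lemma lp_fin_subspace:
  assumes "0 < r"
  shows "smult (lp_fin TYPE('k::real_normed_field) r n) = smult (lp TYPE('k::real_normed_field) r)"
    and "carrier (lp_fin TYPE('k::real_normed_field) r n) =
      {f \<in> carrier (lp TYPE('k::real_normed_field) r). \<forall>i\<in>Sigma UNIV (\<lambda>_. UNIV) - {..<n} \<times> UNIV. seq_coord i f = 0}"
    and "f \<in> carrier (lp_fin TYPE('k::real_normed_field) r n) \<Longrightarrow> qnorm (lp_fin TYPE('k::real_normed_field) r n) f = qnorm (lp TYPE('k::real_normed_field) r) f"
proof -
  show "smult (lp_fin TYPE('k::real_normed_field) r n) = smult (lp TYPE('k::real_normed_field) r)"
    by (simp add: lp_fin_def lp_def smult_lsum scalars_def)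
  have sums: "(\<lambda>i. norm (f i) powr r) sums (\<Sum>i<n. norm (f i) powr r)" if "f \<in> carrier (lp_fin TYPE('k::real_normed_field) r n)" for f
    using that by (intro sums_finite) (auto simp: lp_fin_def)
  have mem: "f \<in> carrier (lp TYPE('k) r) \<longleftrightarrow> summable (\<lambda>i. norm (f i) powr r)" for f
    by (simp add: lp_def carrier_lsum scalars_def)
  have coords: "(\<forall>i\<in>Sigma UNIV (\<lambda>_. UNIV) - {..<n} \<times> UNIV. seq_coord i f = 0) \<longleftrightarrow> (\<forall>i\<ge>n. f i = 0)"
    for f :: "nat \<Rightarrow> 'k"
  proof (intro iffI allI impI ballI)
    show "f i = 0"
      if "\<forall>i\<in>Sigma UNIV (\<lambda>_. UNIV) - {..<n} \<times> UNIV. seq_coord i f = 0" "n \<le> i" for i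
      using bspec[OF that(1), of "(i, ())"] that(2) by simp
    show "seq_coord i f = 0"
      if "\<forall>i\<ge>n. f i = 0" "i \<in> Sigma UNIV (\<lambda>_. UNIV) - {..<n} \<times> UNIV" for i
      using that by (cases i) auto
  qed
  show "carrier (lp_fin TYPE('k::real_normed_field) r n) =
      {f \<in> carrier (lp TYPE('k::real_normed_field) r). \<forall>i\<in>Sigma UNIV (\<lambda>_. UNIV) - {..<n} \<times> UNIV. seq_coord i f = 0}"
    using sums coords by (auto simp: mem lp_fin_def dest: sums_summable)
  show "qnorm (lp_fin TYPE('k::real_normed_field) r n) f = qnorm (lp TYPE('k::real_normed_field) r) f" if "f \<in> carrier (lp_fin TYPE('k::real_normed_field) r n)"
    using sums_unique[OF sums[OF that]] by (simp add: lp_fin_def lp_def qnorm_lsum scalars_def)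
qed

lemma coordinate_space_lp_fin:
  assumes "0 < r" "r \<le> p"
  shows "coordinate_space (lp_fin TYPE('k::real_normed_field) r n) (2 * 1 * 2 powr (1 / r)) ({..<n} \<times> UNIV)
    seq_coord seq_unit p 1"
  using assms(1) by (intro coordinate_subspace[OF coordinate_space_lp[OF assms] _ lp_fin_subspace]) auto

lemma lr_block_lp_fin:
  assumes "0 < r" "lr_block (lp TYPE('k::real_normed_field) r) seq_coord seq_unit s J" "J \<subseteq> {..<n} \<times> UNIV"
  shows "lr_block (lp_fin TYPE('k::real_normed_field) r n) seq_coord seq_unit s J"
proof -
  interpret coordinate_space "lp_fin TYPE('k) r n" "2 * 1 * 2 powr (1 / r)" "{..<n} \<times> UNIV" seq_coord seq_unit r 1
    using assms(1) by (intro coordinate_space_lp_fin) auto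
  show ?thesis
  proof (rule lr_block_subspace[OF assms(2) quasi_normed_space_axioms])
    show "seq_unit i \<in> carrier (lp_fin TYPE('k) r n)" if "i \<in> J" for i
      by (rule e_carrier) (use that assms(3) in blast)
    show "carrier (lp_fin TYPE('k) r n) \<subseteq> carrier (lp TYPE('k) r)"
      using lp_fin_subspace(2)[OF assms(1)] by blast
  qed (rule lp_fin_subspace(3)[OF assms(1)])
qed

section \<open>Direct sums of two spaces\<close>

lemma
  fixes X :: "('k::real_normed_field, 'v::ab_group_add) qspace"
    and Y :: "('k, 'w::ab_group_add) qspace"
  shows carrier_dsum: "carrier (X \<oplus> Y) = carrier X \<times> carrier Y"
    and smult_dsum: "smult (X \<oplus> Y) a h = (smult X a (fst h), smult Y a (snd h))"
    and qnorm_dsum: "qnorm (X \<oplus> Y) h = max (qnorm X (fst h)) (qnorm Y (snd h))"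
  by (simp_all add: dsum_def case_prod_beta)

abbreviation "dsum_coord c c' \<equiv> case_sum (\<lambda>i h. c i (fst h)) (\<lambda>j h. c' j (snd h))"
abbreviation "dsum_unit e e' \<equiv> case_sum (\<lambda>i. (e i, 0)) (\<lambda>j. (0, e' j))"

text \<open>The maximum dominates both components, so \<open>\<kappa> + \<kappa>'\<close> and
  \<open>L + L'\<close> are common bounds. Both summands carry the same exponent
  \<open>p\<close>.\<close>

lemma coordinate_space_dsum:
  fixes X :: "('k::real_normed_field, 'v::ab_group_add) qspace"
    and Y :: "('k, 'w::ab_group_add) qspace"
  assumes X: "coordinate_space X \<kappa> I c e p L" and Y: "coordinate_space Y \<kappa>' I' c' e' p L'"
  shows "coordinate_space (X \<oplus> Y) (\<kappa> + \<kappa>') (I <+> I') (dsum_coord c c') (dsum_unit e e') p (L + L')"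
proof -
  interpret X: coordinate_space X \<kappa> I c e p L
    by (rule X)
  interpret Y: coordinate_space Y \<kappa>' I' c' e' p L'
    by (rule Y)
  interpret S: quasi_normed_space "X \<oplus> Y" "\<kappa> + \<kappa>'"
  proof (rule quasi_normed_space.intro)
    show "module (smult (X \<oplus> Y))"
      by (rule module.intro)
        (auto simp: smult_dsum X.vec.scale_right_distrib X.vec.scale_left_distrib
          Y.vec.scale_right_distrib Y.vec.scale_left_distrib)
    show "qnorm (X \<oplus> Y) (smult (X \<oplus> Y) a f) = norm a * qnorm (X \<oplus> Y) f"
      if "f \<in> carrier (X \<oplus> Y)" for a f
      using that by (auto simp: carrier_dsum smult_dsum qnorm_dsum X.qnorm_smult Y.qnorm_smult
          max_mult_distrib_left)
    show "qnorm (X \<oplus> Y) (f + g) \<le> (\<kappa> + \<kappa>') * (qnorm (X \<oplus> Y) f + qnorm (X \<oplus> Y) g)"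
      if "f \<in> carrier (X \<oplus> Y)" "g \<in> carrier (X \<oplus> Y)" for f g
    proof -
      have fg: "fst f \<in> carrier X" "fst g \<in> carrier X" "snd f \<in> carrier Y" "snd g \<in> carrier Y"
        using that by (auto simp: carrier_dsum)
      define M where "M = qnorm (X \<oplus> Y) f + qnorm (X \<oplus> Y) g"
      have M: "qnorm X (fst f) + qnorm X (fst g) \<le> M" "qnorm Y (snd f) + qnorm Y (snd g) \<le> M"
        by (auto simp: M_def qnorm_dsum)
      have "0 \<le> M"
        using M(1) X.qnorm_nonneg fg by (smt (verit))
      have "qnorm X (fst f + fst g) \<le> \<kappa> * (qnorm X (fst f) + qnorm X (fst g))"
        using fg by (intro X.qnorm_add)
      also have "\<dots> \<le> (\<kappa> + \<kappa>') * M"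
        using M(1) \<open>0 \<le> M\<close> X.\<kappa>_pos Y.\<kappa>_pos fg by (intro mult_mono) (auto simp: X.qnorm_nonneg)
      finally have "qnorm X (fst f + fst g) \<le> (\<kappa> + \<kappa>') * M" .
      moreover have "qnorm Y (snd f + snd g) \<le> \<kappa>' * (qnorm Y (snd f) + qnorm Y (snd g))"
        using fg by (intro Y.qnorm_add)
      then have "qnorm Y (snd f + snd g) \<le> (\<kappa> + \<kappa>') * M"
      proof (rule order_trans)
        show "\<kappa>' * (qnorm Y (snd f) + qnorm Y (snd g)) \<le> (\<kappa> + \<kappa>') * M"
          using M(2) \<open>0 \<le> M\<close> X.\<kappa>_pos Y.\<kappa>_pos fg by (intro mult_mono) (auto simp: Y.qnorm_nonneg)
      qed
      ultimately show ?thesis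
        unfolding M_def by (simp add: qnorm_dsum[of X Y "f + g"])
    qed
    show "0 \<le> qnorm (X \<oplus> Y) f" if "f \<in> carrier (X \<oplus> Y)" for f
      using that X.qnorm_nonneg[of "fst f"] by (auto simp: qnorm_dsum carrier_dsum)
    show "0 < \<kappa> + \<kappa>'"
      using X.\<kappa>_pos Y.\<kappa>_pos by simp
  qed (auto simp: carrier_dsum smult_dsum X.zero_carrier Y.zero_carrier zero_prod_def
      X.add_carrier Y.add_carrier X.smult_carrier Y.smult_carrier)
  have c_zero: "i \<in> I \<Longrightarrow> c i 0 = 0" and c'_zero: "j \<in> I' \<Longrightarrow> c' j 0 = 0" for i j
    using X.linear_functional_zero X.linear_c Y.linear_functional_zero Y.linear_c by blast+
  show ?thesis
  proof
    show "0 < p" "0 < L + L'"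
      using X.p_pos X.L_pos Y.L_pos by auto
    show "linear_functional (X \<oplus> Y) (dsum_coord c c' i)" if "i \<in> I <+> I'" for i
      using that X.linear_c Y.linear_c
      by (auto simp: linear_functional_def carrier_dsum smult_dsum)
    show "dsum_unit e e' i \<in> carrier (X \<oplus> Y)" if "i \<in> I <+> I'" for i
      using that by (auto simp: carrier_dsum X.e_carrier Y.e_carrier X.zero_carrier Y.zero_carrier)
    show "qnorm (X \<oplus> Y) (dsum_unit e e' i) \<le> 1" if "i \<in> I <+> I'" for i
      using that by (auto simp: qnorm_dsum X.qnorm_e Y.qnorm_e X.qnorm_zero Y.qnorm_zero)
    show "dsum_coord c c' i (dsum_unit e e' j) = (if i = j then 1 else 0)"
      if "i \<in> I <+> I'" "j \<in> I <+> I'" for i j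
      using that by (auto simp: X.c_e Y.c_e c_zero c'_zero split: if_splits)
  next
    fix F and h assume F: "finite F" "F \<subseteq> I <+> I'" and h: "h \<in> carrier (X \<oplus> Y)"
    have F_eq: "F = Inl -` F <+> Inr -` F"
      by (auto simp: Plus_def image_iff) (metis sumE)
    have fin: "finite (Inl -` F)" "finite (Inr -` F)"
      using F(1) by (auto intro: finite_vimageI)
    have le: "qnorm X (fst h) powr p \<le> qnorm (X \<oplus> Y) h powr p" "qnorm Y (snd h) powr p \<le> qnorm (X \<oplus> Y) h powr p"
      using h X.p_pos by (auto simp: carrier_dsum qnorm_dsum X.qnorm_nonneg Y.qnorm_nonneg intro!: powr_mono2)
    have "(\<Sum>i\<in>F. norm (dsum_coord c c' i h) powr p) =
        (\<Sum>i\<in>Inl -` F. norm (c i (fst h)) powr p) + (\<Sum>j\<in>Inr -` F. norm (c' j (snd h)) powr p)"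
      using fin by (subst F_eq, subst sum.Plus) simp_all
    also have "\<dots> \<le> L * qnorm X (fst h) powr p + L' * qnorm Y (snd h) powr p"
      using fin F h by (intro add_mono X.sum_c_le Y.sum_c_le) (auto simp: carrier_dsum)
    also have "\<dots> \<le> L * qnorm (X \<oplus> Y) h powr p + L' * qnorm (X \<oplus> Y) h powr p"
      using le X.L_pos Y.L_pos by (intro add_mono mult_left_mono) auto
    finally show "(\<Sum>i\<in>F. norm (dsum_coord c c' i h) powr p) \<le> (L + L') * qnorm (X \<oplus> Y) h powr p"
      by (simp add: algebra_simps)
  next
    fix h and r :: real assume h: "h \<in> carrier (X \<oplus> Y)" and r: "0 < r"
    obtain F where F: "finite F" "F \<subseteq> I"
      "qnorm X (fst h - (\<Sum>i\<in>F. smult X (c i (fst h)) (e i))) < r"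
      using X.dense_e[of "fst h" r] h r by (auto simp: carrier_dsum)
    obtain F' where F': "finite F'" "F' \<subseteq> I'"
      "qnorm Y (snd h - (\<Sum>j\<in>F'. smult Y (c' j (snd h)) (e' j))) < r"
      using Y.dense_e[of "snd h" r] h r by (auto simp: carrier_dsum)
    have "(\<Sum>i\<in>F <+> F'. smult (X \<oplus> Y) (dsum_coord c c' i h) (dsum_unit e e' i)) =
        (\<Sum>i\<in>F. smult X (c i (fst h)) (e i), \<Sum>j\<in>F'. smult Y (c' j (snd h)) (e' j))"
      using F(1) F'(1) by (simp add: sum.Plus smult_dsum prod_eq_iff fst_sum snd_sum)
    then show "\<exists>F. finite F \<and> F \<subseteq> I <+> I' \<and>
        qnorm (X \<oplus> Y) (h - (\<Sum>i\<in>F. smult (X \<oplus> Y) (dsum_coord c c' i h) (dsum_unit e e' i))) < r"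
      using F F' by (intro exI[of _ "F <+> F'"]) (auto simp: qnorm_dsum finite_Plus)
  qed
qed

lemma lr_block_dsum:
  fixes X :: "('k::real_normed_field, 'v::ab_group_add) qspace"
    and Y :: "('k, 'w::ab_group_add) qspace"
  assumes X: "quasi_normed_space X \<kappa>" and Y: "quasi_normed_space Y \<kappa>'" and s: "0 < s"
  shows lr_block_Inl: "lr_block X c e s J \<Longrightarrow> lr_block (X \<oplus> Y) (dsum_coord c c') (dsum_unit e e') s (Inl ` J)"
    and lr_block_Inr: "lr_block Y c' e' s J' \<Longrightarrow> lr_block (X \<oplus> Y) (dsum_coord c c') (dsum_unit e e') s (Inr ` J')"
proof -
  interpret X: quasi_normed_space X \<kappa>
    by (rule X)
  interpret Y: quasi_normed_space Y \<kappa>'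
    by (rule Y)
  have sum_Inl: "(\<Sum>i\<in>Inl ` S. dsum_unit e e' i) = (\<Sum>i\<in>S. e i, 0)" for S
    by (simp add: sum.reindex prod_eq_iff fst_sum snd_sum)
  have sum_Inr: "(\<Sum>i\<in>Inr ` S. dsum_unit e e' i) = (0, \<Sum>i\<in>S. e' i)" for S
    by (simp add: sum.reindex prod_eq_iff fst_sum snd_sum)
  have le: "qnorm X (fst h) powr s \<le> qnorm (X \<oplus> Y) h powr s" "qnorm Y (snd h) powr s \<le> qnorm (X \<oplus> Y) h powr s"
    if "h \<in> carrier (X \<oplus> Y)" for h
    using that s by (auto simp: carrier_dsum qnorm_dsum X.qnorm_nonneg Y.qnorm_nonneg intro!: powr_mono2)
  show "lr_block (X \<oplus> Y) (dsum_coord c c') (dsum_unit e e') s (Inl ` J)" if J: "lr_block X c e s J"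
    unfolding lr_block_def
  proof (intro conjI allI ballI impI)
    show "finite (Inl ` J)"
      using J by (simp add: lr_block_def)
    show "qnorm (X \<oplus> Y) (\<Sum>i\<in>S. dsum_unit e e' i) \<le> card (Inl ` J) powr (1 / s)" if "S \<subseteq> Inl ` J" for S
    proof -
      obtain T where T: "T \<subseteq> J" "S = Inl ` T"
        using \<open>S \<subseteq> _\<close> by (rule subset_imageE)
      then show ?thesis
        using J by (simp add: sum_Inl qnorm_dsum Y.qnorm_zero card_image lr_block_def)
    qed
    show "(\<Sum>i\<in>Inl ` J. norm (dsum_coord c c' i h) powr s) \<le> qnorm (X \<oplus> Y) h powr s"
      if h: "h \<in> carrier (X \<oplus> Y)" for h
      using J le(1)[OF h] h by (auto simp: sum.reindex lr_block_def carrier_dsum intro: order_trans)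
  qed
  show "lr_block (X \<oplus> Y) (dsum_coord c c') (dsum_unit e e') s (Inr ` J')" if J: "lr_block Y c' e' s J'"
    unfolding lr_block_def
  proof (intro conjI allI ballI impI)
    show "finite (Inr ` J')"
      using J by (simp add: lr_block_def)
    show "qnorm (X \<oplus> Y) (\<Sum>i\<in>S. dsum_unit e e' i) \<le> card (Inr ` J') powr (1 / s)" if "S \<subseteq> Inr ` J'" for S
    proof -
      obtain T where T: "T \<subseteq> J'" "S = Inr ` T"
        using \<open>S \<subseteq> _\<close> by (rule subset_imageE)
      then show ?thesis
        using J by (simp add: sum_Inr qnorm_dsum X.qnorm_zero card_image lr_block_def)
    qed
    show "(\<Sum>i\<in>Inr ` J'. norm (dsum_coord c c' i h) powr s) \<le> qnorm (X \<oplus> Y) h powr s"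
      if h: "h \<in> carrier (X \<oplus> Y)" for h
      using J le(2)[OF h] h by (auto simp: sum.reindex lr_block_def carrier_dsum intro: order_trans)
  qed
qed

section \<open>The five spaces\<close>

lemma no_almost_greedy_basis_lp_dsum:
  assumes "0 < q" "q < p" "p < 1"
  shows "\<not> has_almost_greedy_basis (lp TYPE('k::real_normed_field) p \<oplus> lp TYPE('k) q)"
proof -
  let ?c = "dsum_coord seq_coord seq_coord" and ?e = "dsum_unit seq_unit seq_unit"
  interpret P: coordinate_space "lp TYPE('k) p" "2 * 1 * 2 powr (1 / p)" "Sigma UNIV (\<lambda>_. UNIV)" seq_coord seq_unit p 1
    using assms by (intro coordinate_space_lp) auto
  \<comment> \<open>\<open>\<ell>\<^sub>q\<close> is given the exponent \<open>p\<close>, as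
    \<open>q \<le> p\<close> permits, so that it matches the first summand. Its blocks still have
    the exponent \<open>q\<close>.\<close>
  interpret Q: coordinate_space "lp TYPE('k) q" "2 * 1 * 2 powr (1 / q)" "Sigma UNIV (\<lambda>_. UNIV)" seq_coord seq_unit p 1
    using assms by (intro coordinate_space_lp) auto
  have p: "0 < p"
    using assms by simp
  have blocks: "lr_block (lp TYPE('k) p \<oplus> lp TYPE('k) q) ?c ?e p (Inl ` (\<lambda>n. (n, ())) ` {..<m})"
    "lr_block (lp TYPE('k) p \<oplus> lp TYPE('k) q) ?c ?e q (Inr ` (\<lambda>n. (n, ())) ` {..<m})" for m
    by (rule lr_block_Inl[OF P.quasi_normed_space_axioms Q.quasi_normed_space_axioms p lr_block_lp(1)[OF p p]]
        lr_block_Inr[OF P.quasi_normed_space_axioms Q.quasi_normed_space_axioms assms(1)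
          lr_block_lp(1)[OF assms(1) assms(1)]])+
  have card: "card (Inl ` (\<lambda>n. (n, ())) ` {..<m}) = m" "card (Inr ` (\<lambda>n. (n, ())) ` {..<m}) = m" for m :: nat
    by (simp_all add: card_image inj_on_def)
  show ?thesis
  proof (rule coordinate_space.no_almost_greedy_basis)
    show "coordinate_space (lp TYPE('k) p \<oplus> lp TYPE('k) q) (2 * 1 * 2 powr (1 / p) + 2 * 1 * 2 powr (1 / q))
        (Sigma UNIV (\<lambda>_. UNIV) <+> Sigma UNIV (\<lambda>_. UNIV)) ?c ?e p (1 + 1)"
      by (intro coordinate_space_dsum P.coordinate_space_axioms Q.coordinate_space_axioms)
    show "\<exists>J\<subseteq>Sigma UNIV (\<lambda>_. UNIV) <+> Sigma UNIV (\<lambda>_. UNIV).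
        card J = m \<and> lr_block (lp TYPE('k) p \<oplus> lp TYPE('k) q) ?c ?e p J" for m
      using blocks(1)[of m] card(1)[of m] by (intro exI[of _ "Inl ` (\<lambda>n. (n, ())) ` {..<m}"]) auto
    show "\<exists>J\<subseteq>Sigma UNIV (\<lambda>_. UNIV) <+> Sigma UNIV (\<lambda>_. UNIV).
        card J = m \<and> lr_block (lp TYPE('k) p \<oplus> lp TYPE('k) q) ?c ?e q J" for m
      using blocks(2)[of m] card(2)[of m] by (intro exI[of _ "Inr ` (\<lambda>n. (n, ())) ` {..<m}"]) auto
  qed (use assms in auto)
qed

text \<open>The two exponents come from the two directions: columns yield the outer exponent
  \<open>r\<close>, rows the inner exponent \<open>s\<close>.\<close>

lemma lsum_blocks:
  fixes X :: "nat \<Rightarrow> ('k::real_normed_field, 'v::ab_group_add) qspace"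
  assumes r: "0 < r" and s: "0 < s" and X: "\<And>n. coordinate_space (X n) \<kappa> (I n) c e p L"
    and j: "\<And>n. j \<in> I n" "\<And>n. lr_block (X n) c e s {j}"
    and rows: "\<And>m. \<exists>n. \<exists>J\<subseteq>I n. card J = m \<and> lr_block (X n) c e s J"
  shows "\<exists>J\<subseteq>Sigma UNIV I. card J = m \<and> lr_block (lsum r X) (lsum_coord c) (lsum_unit e) r J"
    and "\<exists>J\<subseteq>Sigma UNIV I. card J = m \<and> lr_block (lsum r X) (lsum_coord c) (lsum_unit e) s J"
proof -
  interpret X: coordinate_space "X k" \<kappa> "I k" c e p L for k
    by (rule X)
  have "lr_block (lsum r X) (lsum_coord c) (lsum_unit e) r ((\<lambda>n. (n, j)) ` {..<m})"
    using j by (intro lr_block_column[OF r s X.quasi_normed_space_axioms] X.e_carrier) auto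
  moreover have "card ((\<lambda>n. (n, j)) ` {..<m}) = m"
    by (simp add: card_image inj_on_def)
  ultimately show "\<exists>J\<subseteq>Sigma UNIV I. card J = m \<and> lr_block (lsum r X) (lsum_coord c) (lsum_unit e) r J"
    using j by (intro exI[of _ "(\<lambda>n. (n, j)) ` {..<m}"]) auto
  obtain n J where J: "J \<subseteq> I n" "card J = m" "lr_block (X n) c e s J"
    using rows by blast
  have "lr_block (lsum r X) (lsum_coord c) (lsum_unit e) s (Pair n ` J)"
    using J by (intro lr_block_row[OF r s X.quasi_normed_space_axioms] X.e_carrier) auto
  moreover have "card (Pair n ` J) = m"
    using J(2) by (simp add: card_image inj_on_def)
  ultimately show "\<exists>J\<subseteq>Sigma UNIV I. card J = m \<and> lr_block (lsum r X) (lsum_coord c) (lsum_unit e) s J"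
    using J by (intro exI[of _ "Pair n ` J"]) auto
qed

text \<open>Whichever of \<open>p\<close> and \<open>q\<close> is the outer exponent, columns and
  rows together provide blocks for both.\<close>

lemma no_almost_greedy_basis_lsum:
  fixes X :: "nat \<Rightarrow> ('k::real_normed_field, 'v::ab_group_add) qspace"
  assumes q: "0 < q" "q < p" "p < 1" and rs: "r = p \<and> s = q \<or> r = q \<and> s = p"
    and X: "\<And>n. coordinate_space (X n) \<kappa> (I n) c e p L"
    and j: "\<And>n. j \<in> I n" "\<And>n. lr_block (X n) c e s {j}"
    and rows: "\<And>m. \<exists>n. \<exists>J\<subseteq>I n. card J = m \<and> lr_block (X n) c e s J"
  shows "\<not> has_almost_greedy_basis (lsum r X)"
proof (rule coordinate_space.no_almost_greedy_basis)
  have r: "0 < r" "r \<le> p" and s: "0 < s"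
    using q rs by auto
  show "coordinate_space (lsum r X) (2 * \<kappa> * 2 powr (1 / r)) (Sigma UNIV I) (lsum_coord c) (lsum_unit e) p L"
    by (rule coordinate_space_lsum[OF r X])
  note blocks = lsum_blocks[OF r(1) s X j rows]
  show "\<exists>J\<subseteq>Sigma UNIV I. card J = m \<and> lr_block (lsum r X) (lsum_coord c) (lsum_unit e) p J" for m
    using rs blocks[of m] by blast
  show "\<exists>J\<subseteq>Sigma UNIV I. card J = m \<and> lr_block (lsum r X) (lsum_coord c) (lsum_unit e) q J" for m
    using rs blocks[of m] by blast
qed (use q in auto)

lemma no_almost_greedy_basis_lsum_lp:
  assumes q: "0 < q" "q < p" "p < 1" and rs: "r = p \<and> s = q \<or> r = q \<and> s = p"
  shows "\<not> has_almost_greedy_basis (lsum r (\<lambda>_. lp TYPE('k::real_normed_field) s))"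
    and "\<not> has_almost_greedy_basis (lsum r (\<lambda>n. lp_fin TYPE('k::real_normed_field) s (Suc n)))"
proof -
  have s: "0 < s" "s \<le> p"
    using q rs by auto
  have card: "card ((\<lambda>n. (n, ())) ` {..<m}) = m" for m :: nat
    by (simp add: card_image inj_on_def)
  show "\<not> has_almost_greedy_basis (lsum r (\<lambda>_. lp TYPE('k::real_normed_field) s))"
  proof (rule no_almost_greedy_basis_lsum[OF q rs coordinate_space_lp[OF s]])
    show "lr_block (lp TYPE('k) s) seq_coord seq_unit s {(0, ())}"
      by (rule lr_block_lp(2)[OF s(1) s(1)])
    show "\<exists>n::nat. \<exists>J\<subseteq>Sigma UNIV (\<lambda>_. UNIV). card J = m \<and> lr_block (lp TYPE('k) s) seq_coord seq_unit s J" for m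
      using lr_block_lp(1)[where 'k = 'k, OF s(1) s(1), of m] card[of m]
      by (intro exI[of _ 0] exI[of _ "(\<lambda>n. (n, ())) ` {..<m}"]) auto
  qed auto
  \<comment> \<open>The dimensions start at \<open>1\<close> and the indices at \<open>0\<close>,
    whence \<open>Suc n\<close>. Every index set therefore contains \<open>(0, ())\<close>, and the
    first unit vectors form a column.\<close>
  show "\<not> has_almost_greedy_basis (lsum r (\<lambda>n. lp_fin TYPE('k::real_normed_field) s (Suc n)))"
  proof (rule no_almost_greedy_basis_lsum[OF q rs coordinate_space_lp_fin[OF s]])
    show "lr_block (lp_fin TYPE('k) s (Suc n)) seq_coord seq_unit s {(0, ())}" for n
      by (rule lr_block_lp_fin[OF s(1) lr_block_lp(2)[OF s(1) s(1)]]) auto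
    show "\<exists>n. \<exists>J\<subseteq>{..<Suc n} \<times> UNIV. card J = m \<and> lr_block (lp_fin TYPE('k) s (Suc n)) seq_coord seq_unit s J" for m
    proof -
      \<comment> \<open>Component \<open>m\<close> has dimension \<open>m + 1\<close>, enough for a
        block of size \<open>m\<close>.\<close>
      have "lr_block (lp_fin TYPE('k) s (Suc m)) seq_coord seq_unit s ((\<lambda>n. (n, ())) ` {..<m})"
        by (rule lr_block_lp_fin[OF s(1) lr_block_lp(1)[OF s(1) s(1)]]) auto
      then show ?thesis
        using card[of m] by (intro exI[of _ m] exI[of _ "(\<lambda>n. (n, ())) ` {..<m}"]) auto
    qed
  qed auto
qed

theorem mainTheorem3:
  fixes p q :: real
  assumes "0 < q" and "q < p" and "p < 1"
  shows
    "\<not> has_almost_greedy_basis (lp TYPE(real) p \<oplus> lp TYPE(real) q) \<and>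
     \<not> has_almost_greedy_basis (lsum p (\<lambda>_. lp TYPE(real) q)) \<and>
     \<not> has_almost_greedy_basis (lsum q (\<lambda>_. lp TYPE(real) p)) \<and>
     \<not> has_almost_greedy_basis (lsum p (\<lambda>n. lp_fin TYPE(real) q (Suc n))) \<and>
     \<not> has_almost_greedy_basis (lsum q (\<lambda>n. lp_fin TYPE(real) p (Suc n))) \<and>
     \<not> has_almost_greedy_basis (lp TYPE(complex) p \<oplus> lp TYPE(complex) q) \<and>
     \<not> has_almost_greedy_basis (lsum p (\<lambda>_. lp TYPE(complex) q)) \<and>
     \<not> has_almost_greedy_basis (lsum q (\<lambda>_. lp TYPE(complex) p)) \<and>
     \<not> has_almost_greedy_basis (lsum p (\<lambda>n. lp_fin TYPE(complex) q (Suc n))) \<and>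
     \<not> has_almost_greedy_basis (lsum q (\<lambda>n. lp_fin TYPE(complex) p (Suc n)))"
proof -
  \<comment> \<open>These equations select the outer exponent: \<open>p\<close> for
    \<open>pq\<close> and \<open>q\<close> for \<open>qp\<close>.\<close>
  have pq: "p = p \<and> q = q \<or> p = q \<and> q = p" and qp: "q = p \<and> p = q \<or> q = q \<and> p = p"
    by simp_all
  show ?thesis
    by (intro conjI no_almost_greedy_basis_lp_dsum[OF assms]
        no_almost_greedy_basis_lsum_lp[OF assms pq] no_almost_greedy_basis_lsum_lp[OF assms qp])
qed

end
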